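(* Let $R=\bigoplus_{i\in\mathbb N}R_i$ be a standard $\mathbb N$-graded ring over a separably closed field $k$, i.e. $R_0=k$ and $R$ is finitely generated as a $k$-algebra by $R_1$. If $\operatorname{depth}(R)\geq 3$, then $\widetilde{H}_0(\Delta(R);k)=\widetilde{H}_1(\Delta(R);k)=0$.
   Context: For such a graded ring $R$, let $\mathfrak m=\bigoplus_{i>0}R_i$ be the ideal of elements of positive degree and let $\mathfrak p_1,\dots,\mathfrak p_n$ be the minimal primes of $R$. $\Delta(R)$ is the simplicial complex on the vertex set $\{1,\dots,n\}$ in which a subset $\{i_0,\dots,i_s\}$ is a face if and only if $\sqrt{\mathfrak p_{i_0}+\cdots+\mathfrak p_{i_s}}\neq\mathfrak m$. $\widetilde{H}_j(\Delta(R);k)$ denotes the $j$-th reduced homology of $\Delta(R)$ with coefficients in $k$. The depth is taken with respect to $\mathfrak m$. *)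

theory Defs
  imports "HOL-Computational_Algebra.Polynomial"
begin

definition separably_closed :: "('k::field) itself \<Rightarrow> bool" where
  "separably_closed _ \<longleftrightarrow>
     (\<forall>p :: 'k poly. degree p \<ge> 1 \<and> coprime p (pderiv p) \<longrightarrow> (\<exists>x. poly p x = 0))"

definition is_ideal :: "('r::comm_ring_1) set \<Rightarrow> bool" where
  "is_ideal I \<longleftrightarrow> 0 \<in> I \<and> (\<forall>a\<in>I. \<forall>b\<in>I. a + b \<in> I) \<and> (\<forall>a\<in>I. \<forall>r. r * a \<in> I)"

definition gen_ideal :: "('r::comm_ring_1) set \<Rightarrow> 'r set" where
  "gen_ideal S = \<Inter> {J. is_ideal J \<and> S \<subseteq> J}"

definition ideal_sum :: "('r::comm_ring_1) set set \<Rightarrow> 'r set" where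
  "ideal_sum F = gen_ideal (\<Union> F)"

definition radical :: "('r::comm_ring_1) set \<Rightarrow> 'r set" where
  "radical I = {x. \<exists>n::nat. x ^ n \<in> I}"

definition is_prime_ideal :: "('r::comm_ring_1) set \<Rightarrow> bool" where
  "is_prime_ideal P \<longleftrightarrow> is_ideal P \<and> 1 \<notin> P \<and> (\<forall>a b. a * b \<in> P \<longrightarrow> a \<in> P \<or> b \<in> P)"

definition is_minimal_prime :: "('r::comm_ring_1) set \<Rightarrow> bool" where
  "is_minimal_prime P \<longleftrightarrow> is_prime_ideal P \<and> \<not> (\<exists>Q. is_prime_ideal Q \<and> Q \<subset> P)"

text \<open>The k-algebra structure of R is given by a ring homomorphism phi : k -> R;
the grading by the family of additive subgroups gr i = R_i.\<close>

inductive_set alg_gen :: "('k::field \<Rightarrow> 'r::comm_ring_1) \<Rightarrow> 'r set \<Rightarrow> 'r set"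
  for \<phi> :: "'k \<Rightarrow> 'r" and G :: "'r set" where
  const: "\<phi> a \<in> alg_gen \<phi> G"
| gen: "g \<in> G \<Longrightarrow> g \<in> alg_gen \<phi> G"
| add: "x \<in> alg_gen \<phi> G \<Longrightarrow> y \<in> alg_gen \<phi> G \<Longrightarrow> x + y \<in> alg_gen \<phi> G"
| mult: "x \<in> alg_gen \<phi> G \<Longrightarrow> y \<in> alg_gen \<phi> G \<Longrightarrow> x * y \<in> alg_gen \<phi> G"

definition graded_algebra :: "('k::field \<Rightarrow> 'r::comm_ring_1) \<Rightarrow> (nat \<Rightarrow> 'r set) \<Rightarrow> bool" where
  "graded_algebra \<phi> gr \<longleftrightarrow>
     \<comment> \<open>phi is an (injective) ring homomorphism, making R a k-algebra\<close>
     (\<forall>a b. \<phi> (a + b) = \<phi> a + \<phi> b) \<and> (\<forall>a b. \<phi> (a * b) = \<phi> a * \<phi> b) \<and> \<phi> 1 = 1 \<and> inj \<phi> \<and>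
     \<comment> \<open>each R_i is a k-subspace\<close>
     (\<forall>i. 0 \<in> gr i \<and> (\<forall>x\<in>gr i. \<forall>y\<in>gr i. x + y \<in> gr i) \<and> (\<forall>a. \<forall>x\<in>gr i. \<phi> a * x \<in> gr i)) \<and>
     \<comment> \<open>R_i R_j \<subseteq> R_(i+j)\<close>
     (\<forall>i j. \<forall>x\<in>gr i. \<forall>y\<in>gr j. x * y \<in> gr (i + j)) \<and>
     \<comment> \<open>R is the direct sum of the R_i: existence and uniqueness of decompositions\<close>
     (\<forall>r. \<exists>N c. (\<forall>i. c i \<in> gr i) \<and> r = (\<Sum>i\<le>N. c i)) \<and>
     (\<forall>N c. (\<forall>i. c i \<in> gr i) \<and> (\<Sum>i\<le>N. c i) = 0 \<longrightarrow> (\<forall>i\<le>N. c i = 0))"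

definition standard_graded :: "('k::field \<Rightarrow> 'r::comm_ring_1) \<Rightarrow> (nat \<Rightarrow> 'r set) \<Rightarrow> bool" where
  "standard_graded \<phi> gr \<longleftrightarrow> graded_algebra \<phi> gr \<and> gr 0 = range \<phi> \<and>
     (\<exists>G. finite G \<and> G \<subseteq> gr 1 \<and> (\<forall>r. r \<in> alg_gen \<phi> G))"

definition irrelevant_ideal :: "(nat \<Rightarrow> 'r::comm_ring_1 set) \<Rightarrow> 'r set" where
  "irrelevant_ideal gr = {r. \<exists>N c. (\<forall>i. c i \<in> gr i) \<and> c 0 = 0 \<and> r = (\<Sum>i\<le>N. c i)}"

definition regular_sequence :: "('r::comm_ring_1) list \<Rightarrow> bool" where
  "regular_sequence xs \<longleftrightarrow>
     (\<forall>i < length xs. \<forall>y. xs ! i * y \<in> gen_ideal (set (take i xs)) \<longrightarrow> y \<in> gen_ideal (set (take i xs))) \<and>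
     1 \<notin> gen_ideal (set xs)"

definition depth_ge :: "(nat \<Rightarrow> 'r::comm_ring_1 set) \<Rightarrow> nat \<Rightarrow> bool" where
  "depth_ge gr d \<longleftrightarrow> (\<exists>xs. length xs = d \<and> set xs \<subseteq> irrelevant_ideal gr \<and> regular_sequence xs)"

text \<open>Given an enumeration p_1,...,p_n of the minimal primes: faces are the subsets F of
{1..n} with sqrt(sum_{i in F} p_i) \<noteq> m; the empty face is included (reduced homology).\<close>
definition Delta :: "(nat \<Rightarrow> 'r::comm_ring_1 set) \<Rightarrow> nat \<Rightarrow> (nat \<Rightarrow> 'r set) \<Rightarrow> nat set set" where
  "Delta gr n p = {F. F \<subseteq> {1..n} \<and> (F = {} \<or> radical (ideal_sum (p ` F)) \<noteq> irrelevant_ideal gr)}"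

text \<open>A (card q)-chain with coefficients in k: a function on faces of cardinality q
(faces of dimension q-1). The face {} spans the augmentation module in degree -1.\<close>
definition is_chain :: "nat set set \<Rightarrow> nat \<Rightarrow> (nat set \<Rightarrow> 'k::field) \<Rightarrow> bool" where
  "is_chain \<Delta> q c \<longleftrightarrow> (\<forall>F. c F \<noteq> 0 \<longrightarrow> F \<in> \<Delta> \<and> card F = q)"

text \<open>Simplicial boundary: for a face F with vertices v_0 < ... < v_s,
d[F] = sum_t (-1)^t [F - {v_t}]. Evaluated at a face G it collects the coefficients of
faces F = G \<union> {v}, with sign (-1)^(number of vertices of F below v).\<close>
definition boundary :: "nat set set \<Rightarrow> (nat set \<Rightarrow> 'k::field) \<Rightarrow> nat set \<Rightarrow> 'k" where
  "boundary \<Delta> c G = (\<Sum>F \<in> {F \<in> \<Delta>. G \<subseteq> F \<and> card F = card G + 1}.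
      (-1) ^ card {x \<in> F. x < the_elem (F - G)} * c F)"

text \<open>Reduced homology in degree j vanishes: every j-cycle is a j-boundary
(j-chains live on faces of cardinality j+1).\<close>
definition reduced_homology_vanishes :: "'k::field itself \<Rightarrow> nat set set \<Rightarrow> nat \<Rightarrow> bool" where
  "reduced_homology_vanishes _ \<Delta> j \<longleftrightarrow>
     (\<forall>c :: nat set \<Rightarrow> 'k. is_chain \<Delta> (j + 1) c \<and> (\<forall>G. boundary \<Delta> c G = 0) \<longrightarrow>
        (\<exists>d. is_chain \<Delta> (j + 2) d \<and> (\<forall>F. boundary \<Delta> d F = c F)))"

end

theory Submission
  imports Defs
begin

text \<open>The complex \<open>\<Delta>(R)\<close> is the nerve of the cover of X = Proj R by its irreducible components
  \<open>X\<^sub>i = V(\<pp>\<^sub>i)\<close>. Let a be a 1-cocycle of \<open>\<Delta>(R)\<close> with values in k. On the open set \<open>U\<^sub>F\<close> of points lying on no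
  component outside the face F, the cocycle is the coboundary of a function \<open>h\<^sub>F\<close> on the vertices of F. On
  \<open>U\<^sub>F \<inter> U\<^sub>H\<close> the difference \<open>h\<^sub>F - h\<^sub>H\<close> is constant, so these differences form a Cech 1-cocycle in k, hence
  in the structure sheaf. Since the depth is at least 3, \<open>H\<^sup>2\<close> of the local cohomology of R vanishes and the cocycle
  is a coboundary of functions \<open>f\<^sub>F\<close> of degree 0. For each i, the functions \<open>f\<^sub>F - h\<^sub>F(i)\<close> agree on \<open>X\<^sub>i\<close> and
  define a global function there, which is algebraic over k, so that a power of it with exponent q = 1 or a power of
  the characteristic is a constant \<open>\<alpha>\<^sub>i\<close> in k. At a point of \<open>X\<^sub>i \<inter> X\<^sub>j\<close> this gives
  \<open>a\<^sub>i\<^sub>j\<^sup>q = \<alpha>\<^sub>i - \<alpha>\<^sub>j\<close>. Thus the q-th power of every cocycle is a coboundary, which forces the homology to vanish.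
  In degree 0 the same gluing, with \<open>H\<^sup>1\<close> in place of \<open>H\<^sup>2\<close>, shows that X is connected.\<close>

section \<open>Reduced homology\<close>

text \<open>The components are closed, and functions need not glue along a closed cover; hence the
  passage to the open sets \<open>U_F\<close>. They cover everything because the components through
  a given point form a face. The vanishing theorem is available for the structure sheaf and not for
  constants, so the splitting takes place there. The way back to k goes through the components: on
  an integral \<open>X_i\<close> a global function of degree 0 is algebraic over k, hence purely
  inseparable over it as k is separably closed. This is the source of q. Passing to q-th powers
  loses nothing because the entries 0, 1, -1 of the boundary matrix are fixed by them. The
  difference of \<open>h_F\<close> and \<open>h_H\<close> is constant on the common vertices since
  both have coboundary a there; without common vertices \<open>U_F\<close> and \<open>U_H\<close>
  are disjoint. R may have nilpotents and no localization is formed: a fraction is a numerator over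
  a power of \<open>s t\<close>, identities hold after multiplication by powers, and exponents are
  made uniform over finite index sets.\<close>

lemma fredholm_alternative:
  fixes M :: "'x \<Rightarrow> 'y \<Rightarrow> 'k::field"
  assumes "finite Y" "finite X"
  shows "(\<exists>d. \<forall>x\<in>X. (\<Sum>y\<in>Y. M x y * d y) = b x) \<or>
         (\<exists>a. (\<forall>y\<in>Y. (\<Sum>x\<in>X. a x * M x y) = 0) \<and> (\<Sum>x\<in>X. a x * b x) = 1)"
  using assms(1)
proof (induction Y arbitrary: b rule: finite_induct)
  case empty
  show ?case
  proof (cases "\<forall>x\<in>X. b x = 0")
    case True
    then show ?thesis by simp
  next
    case False
    then obtain x0 where x0: "x0 \<in> X" "b x0 \<noteq> 0" by blast
    have "(\<Sum>x\<in>X. (if x = x0 then 1 / b x0 else 0) * b x) = 1"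
      using x0 assms(2) by (simp add: if_distrib[of "\<lambda>u. u * _"] cong: if_cong)
    then show ?thesis by (metis empty_iff)
  qed
next
  case (insert y0 Y)
  have ins: "(\<Sum>y\<in>insert y0 Y. M x y * d y) = M x y0 * d y0 + (\<Sum>y\<in>Y. M x y * d y)" for x d
    using insert.hyps by simp
  have ext: "\<exists>d. \<forall>x\<in>X. (\<Sum>y\<in>insert y0 Y. M x y * d y) = b x"
    if "\<forall>x\<in>X. (\<Sum>y\<in>Y. M x y * d y) = b x - e * M x y0" for d e
  proof (intro exI ballI)
    fix x assume "x \<in> X"
    have "(\<Sum>y\<in>Y. M x y * (d(y0 := e)) y) = (\<Sum>y\<in>Y. M x y * d y)"
      using insert.hyps by (intro sum.cong) auto
    then show "(\<Sum>y\<in>insert y0 Y. M x y * (d(y0 := e)) y) = b x"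
      using that \<open>x \<in> X\<close> by (simp only: ins) (simp add: mult.commute)
  qed
  \<comment> \<open>Either column \<open>y0\<close> lies in the span of the columns in
    \<open>Y\<close>, and every functional that kills these kills it too, or some \<open>a\<close>
    kills them and has value 1 on \<open>y0\<close>. In the second case the problem is projected
    along column \<open>y0\<close>.\<close>
  consider (col) d where "\<forall>x\<in>X. (\<Sum>y\<in>Y. M x y * d y) = M x y0"
    | (sep) a where "\<forall>y\<in>Y. (\<Sum>x\<in>X. a x * M x y) = 0" "(\<Sum>x\<in>X. a x * M x y0) = 1"
    using insert.IH[of "\<lambda>x. M x y0"] by blast
  then show ?case
  proof cases
    case col
    show ?thesis
    proof (cases "\<exists>d. \<forall>x\<in>X. (\<Sum>y\<in>Y. M x y * d y) = b x")
      case True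
      then show ?thesis using ext[of _ 0] by auto
    next
      case False
      then obtain a where a: "\<forall>y\<in>Y. (\<Sum>x\<in>X. a x * M x y) = 0" "(\<Sum>x\<in>X. a x * b x) = 1"
        using insert.IH[of b] by blast
      have "(\<Sum>x\<in>X. a x * M x y0) = (\<Sum>x\<in>X. \<Sum>y\<in>Y. d y * (a x * M x y))"
        using col by (intro sum.cong) (auto simp: sum_distrib_left mult_ac simp flip: col[rule_format])
      also have "\<dots> = (\<Sum>y\<in>Y. d y * (\<Sum>x\<in>X. a x * M x y))"
        by (subst sum.swap) (simp add: sum_distrib_left)
      finally show ?thesis using a by auto
    qed
  next
    case sep
    \<comment> \<open>Pairing any solution with \<open>a\<close> shows that its coordinate at
      \<open>y0\<close> must be \<open>?e\<close>.\<close>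
    let ?e = "\<Sum>x\<in>X. a x * b x"
    show ?thesis
    proof (cases "\<exists>d. \<forall>x\<in>X. (\<Sum>y\<in>Y. M x y * d y) = b x - ?e * M x y0")
      case True
      then show ?thesis using ext by blast
    next
      case False
      then obtain a' where a': "\<forall>y\<in>Y. (\<Sum>x\<in>X. a' x * M x y) = 0"
          "(\<Sum>x\<in>X. a' x * (b x - ?e * M x y0)) = 1"
        using insert.IH[of "\<lambda>x. b x - ?e * M x y0"] by blast
      \<comment> \<open>Subtracting \<open>u * a\<close> makes the functional vanish on column
        \<open>y0\<close> as well, and its value on \<open>b\<close> becomes the value of
        \<open>a'\<close> on the projected right-hand side, which is 1.\<close>
      define u where "u = (\<Sum>x\<in>X. a' x * M x y0)"
      have *: "(\<Sum>x\<in>X. (a' x - u * a x) * w x) = (\<Sum>x\<in>X. a' x * w x) - u * (\<Sum>x\<in>X. a x * w x)" for w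
        by (simp add: algebra_simps sum_subtractf sum_distrib_left)
      have "(\<Sum>x\<in>X. a' x * (b x - ?e * M x y0)) = (\<Sum>x\<in>X. a' x * b x) - ?e * u"
        by (simp add: algebra_simps sum_subtractf sum_distrib_left u_def)
      then have "(\<Sum>x\<in>X. (a' x - u * a x) * b x) = 1"
        using a'(2) unfolding * by (simp add: mult.commute)
      moreover have "\<forall>y\<in>insert y0 Y. (\<Sum>x\<in>X. (a' x - u * a x) * M x y) = 0"
        unfolding * using a'(1) sep by (auto simp: u_def)
      ultimately show ?thesis by (intro disjI2 exI conjI)
    qed
  qed
qed

text \<open>Exponents whose power map is additive: 1 in any ring, the characteristic when it is
  prime, and products of these. Working with the property alone treats all characteristics at
  once.\<close>

definition frobenius_exponent :: "'r::comm_ring_1 itself \<Rightarrow> nat \<Rightarrow> bool" where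
  "frobenius_exponent _ q \<longleftrightarrow> q > 0 \<and> (\<forall>x y :: 'r. (x + y) ^ q = x ^ q + y ^ q)"

lemma frobenius_exponent_sum:
  fixes f :: "'b \<Rightarrow> 'r::comm_ring_1"
  assumes "frobenius_exponent TYPE('r) q"
  shows "(\<Sum>i\<in>A. f i) ^ q = (\<Sum>i\<in>A. f i ^ q)"
  using assms by (induction A rule: infinite_finite_induct) (auto simp: frobenius_exponent_def zero_power)

lemma frobenius_exponent_minus:
  fixes x :: "'r::comm_ring_1"
  assumes "frobenius_exponent TYPE('r) q"
  shows "(- x) ^ q = - (x ^ q)"
proof -
  have "(x + - x) ^ q = x ^ q + (- x) ^ q" "q > 0"
    using assms unfolding frobenius_exponent_def by blast+
  then show ?thesis by (simp add: eq_neg_iff_add_eq_0 add.commute zero_power)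
qed

lemma frobenius_exponent_diff:
  fixes x y :: "'r::comm_ring_1"
  assumes "frobenius_exponent TYPE('r) q"
  shows "(x - y) ^ q = x ^ q - y ^ q"
  using assms frobenius_exponent_minus[OF assms, of y]
  unfolding frobenius_exponent_def by (metis add_uminus_conv_diff)

lemma frobenius_exponent_mult:
  assumes "frobenius_exponent TYPE('r::comm_ring_1) q" "frobenius_exponent TYPE('r) q'"
  shows "frobenius_exponent TYPE('r) (q * q')"
  using assms by (auto simp: frobenius_exponent_def power_mult)

lemma frobenius_exponent_1: "frobenius_exponent TYPE('r::comm_ring_1) 1"
  by (simp add: frobenius_exponent_def)

lemma frobenius_exponent_prod:
  assumes "\<And>i. i \<in> A \<Longrightarrow> frobenius_exponent TYPE('r::comm_ring_1) (q i)"
  shows "frobenius_exponent TYPE('r) (prod q A)"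
  using assms
  by (induction A rule: infinite_finite_induct)
    (simp_all add: frobenius_exponent_1[unfolded One_nat_def] frobenius_exponent_mult)

text \<open>The matrix of the simplicial boundary. Summing over the larger face gives the boundary
  of a chain, summing over the smaller face the coboundary of a cochain.\<close>

definition incidence :: "nat set \<Rightarrow> nat set \<Rightarrow> 'k::field" where
  "incidence G F = (if G \<subseteq> F \<and> card F = card G + 1
     then (- 1) ^ card {x \<in> F. x < the_elem (F - G)} else 0)"

lemma boundary_incidence:
  assumes "finite \<Delta>"
  shows "boundary \<Delta> c G = (\<Sum>F\<in>\<Delta>. incidence G F * c F)"
  unfolding boundary_def incidence_def
  by (rule sum.mono_neutral_cong_left) (use assms in auto)

text \<open>The entries are 0, 1 and -1, and additivity of the power map gives
  \<open>(- 1) ^ q = - 1\<close>, also for even \<open>q\<close>.\<close>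

lemma incidence_frobenius:
  assumes "frobenius_exponent TYPE('k) q"
  shows "(incidence G F :: 'k::field) ^ q = incidence G F"
proof -
  have "q > 0" using assms by (simp add: frobenius_exponent_def)
  moreover have "((- 1) ^ m :: 'k) ^ q = (- 1) ^ m" for m :: nat
    using frobenius_exponent_minus[OF assms, of 1] by (simp flip: power_mult add: mult.commute[of m]) (simp add: power_mult)
  ultimately show ?thesis by (simp add: incidence_def)
qed

text \<open>If a cycle c is not a boundary, some cocycle a has \<open>\<langle>a, c\<rangle> = 1\<close>; when \<open>a\<^sup>q\<close> is the coboundary of
  b, raising this to the q-th power gives \<open>1 = \<langle>a\<^sup>q, c\<^sup>q\<rangle> = \<langle>b, (\<partial>c)\<^sup>q\<rangle> = 0\<close>.\<close>

lemma reduced_homology_vanishesI: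
  fixes n :: nat
  assumes sub: "\<Delta> \<subseteq> Pow {1..n}" and down: "\<And>F G. F \<in> \<Delta> \<Longrightarrow> G \<subseteq> F \<Longrightarrow> G \<in> \<Delta>"
    and coh: "\<And>a :: nat set \<Rightarrow> 'k::field.
      (\<And>F. F \<in> \<Delta> \<Longrightarrow> card F = j + 2 \<Longrightarrow> (\<Sum>G\<in>{G\<in>\<Delta>. card G = j + 1}. a G * incidence G F) = 0) \<Longrightarrow>
      \<exists>q b. frobenius_exponent TYPE('k) q \<and>
        (\<forall>G\<in>\<Delta>. card G = j + 1 \<longrightarrow> a G ^ q = (\<Sum>H\<in>\<Delta>. b H * incidence H G))"
  shows "reduced_homology_vanishes TYPE('k) \<Delta> j"
  unfolding reduced_homology_vanishes_def
proof (intro allI impI, elim conjE)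
  fix c :: "nat set \<Rightarrow> 'k"
  assume chain: "is_chain \<Delta> (j + 1) c" and cycle: "\<forall>G. boundary \<Delta> c G = 0"
  have fin: "finite \<Delta>" using sub by (rule finite_subset) simp
  define X where "X = {G\<in>\<Delta>. card G = j + 1}"
  define Y where "Y = {F\<in>\<Delta>. card F = j + 2}"
  have finXY: "finite X" "finite Y" unfolding X_def Y_def using fin by auto
  have supp: "c F = 0" if "F \<notin> X" for F
    using chain that by (auto simp: is_chain_def X_def)
  show "\<exists>d. is_chain \<Delta> (j + 2) d \<and> (\<forall>F. boundary \<Delta> d F = c F)"
  proof (cases "\<exists>d. \<forall>G\<in>X. (\<Sum>F\<in>Y. incidence G F * d F) = c G")
    case True
    then obtain d where d: "\<And>G. G \<in> X \<Longrightarrow> (\<Sum>F\<in>Y. incidence G F * d F) = c G" by blast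
    define d' where "d' F = (if F \<in> Y then d F else 0)" for F
    have eq: "boundary \<Delta> d' G = (\<Sum>F\<in>Y. incidence G F * d F)" for G
      unfolding boundary_incidence[OF fin] d'_def
      by (rule sum.mono_neutral_cong_right) (use fin in \<open>auto simp: Y_def\<close>)
    have "boundary \<Delta> d' G = c G" for G
    proof (cases "G \<in> X")
      case False
      then have "\<forall>F\<in>Y. incidence G F = (0 :: 'k)"
        using down by (auto simp: X_def Y_def incidence_def)
      then show ?thesis using False supp by (simp add: eq)
    qed (simp add: eq d)
    moreover have "is_chain \<Delta> (j + 2) d'" by (auto simp: is_chain_def d'_def Y_def)
    ultimately show ?thesis by blast
  next
    case False
    then obtain a where a: "\<forall>F\<in>Y. (\<Sum>G\<in>X. a G * incidence G F) = 0" "(\<Sum>G\<in>X. a G * c G) = 1"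
      using fredholm_alternative[OF finXY(2,1), of incidence c] by blast
    obtain q b where q: "frobenius_exponent TYPE('k) q"
      and b: "\<And>G. G \<in> X \<Longrightarrow> a G ^ q = (\<Sum>H\<in>\<Delta>. b H * incidence H G)"
      using coh[of a] a(1) unfolding X_def Y_def by auto
    have "1 = (\<Sum>G\<in>X. a G * c G) ^ q" using a(2) by simp
    also have "\<dots> = (\<Sum>G\<in>X. \<Sum>H\<in>\<Delta>. b H * (incidence H G * c G) ^ q)"
      unfolding frobenius_exponent_sum[OF q]
      by (intro sum.cong) (auto simp: power_mult_distrib b sum_distrib_right mult.assoc incidence_frobenius[OF q])
    also have "\<dots> = (\<Sum>H\<in>\<Delta>. b H * (\<Sum>G\<in>X. incidence H G * c G) ^ q)"
      by (subst sum.swap) (simp add: sum_distrib_left frobenius_exponent_sum[OF q])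
    also have "\<dots> = (\<Sum>H\<in>\<Delta>. b H * boundary \<Delta> c H ^ q)"
    proof (intro sum.cong refl)
      fix H
      have "boundary \<Delta> c H = (\<Sum>G\<in>X. incidence H G * c G)"
        unfolding boundary_incidence[OF fin]
        by (rule sum.mono_neutral_right) (use fin supp in \<open>auto simp: X_def\<close>)
      then show "b H * (\<Sum>G\<in>X. incidence H G * c G) ^ q = b H * boundary \<Delta> c H ^ q" by simp
    qed
    also have "\<dots> = 0" using cycle q by (simp add: frobenius_exponent_def zero_power)
    finally show ?thesis by simp
  qed
qed

section \<open>Ideals\<close>

lemma is_idealD:
  assumes "is_ideal I"
  shows "0 \<in> I" "\<And>a b. a \<in> I \<Longrightarrow> b \<in> I \<Longrightarrow> a + b \<in> I" "\<And>a r. a \<in> I \<Longrightarrow> r * a \<in> I"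
    "\<And>a r. a \<in> I \<Longrightarrow> a * r \<in> I" "\<And>a. a \<in> I \<Longrightarrow> - a \<in> I"
    "\<And>a b. a \<in> I \<Longrightarrow> b \<in> I \<Longrightarrow> a - b \<in> I"
proof -
  show *: "0 \<in> I" "\<And>a b. a \<in> I \<Longrightarrow> b \<in> I \<Longrightarrow> a + b \<in> I" "\<And>a r. a \<in> I \<Longrightarrow> r * a \<in> I"
    using assms by (auto simp: is_ideal_def)
  show "\<And>a r. a \<in> I \<Longrightarrow> a * r \<in> I" by (metis *(3) mult.commute)
  show neg: "\<And>a. a \<in> I \<Longrightarrow> - a \<in> I" by (metis *(3) mult_minus1)
  show "\<And>a b. a \<in> I \<Longrightarrow> b \<in> I \<Longrightarrow> a - b \<in> I" by (metis *(2) neg add_uminus_conv_diff)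
qed

lemma is_ideal_sum: "is_ideal I \<Longrightarrow> (\<And>i. i \<in> A \<Longrightarrow> f i \<in> I) \<Longrightarrow> sum f A \<in> I"
  by (induction A rule: infinite_finite_induct) (auto simp: is_idealD)

lemma is_ideal_power_mono: "is_ideal I \<Longrightarrow> x ^ m \<in> I \<Longrightarrow> m \<le> n \<Longrightarrow> x ^ n \<in> I"
  by (metis is_idealD(4) le_add_diff_inverse power_add)

lemma is_ideal_power_diff: "is_ideal I \<Longrightarrow> x - y \<in> I \<Longrightarrow> x ^ n - y ^ n \<in> I"
  using power_diff_sumr2[of x n y] by (simp add: is_idealD)

lemma is_ideal_gen_ideal: "is_ideal (gen_ideal S)"
  unfolding gen_ideal_def is_ideal_def by blast

lemma gen_ideal_superset: "S \<subseteq> gen_ideal S"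
  unfolding gen_ideal_def by blast

lemma gen_ideal_subset: "is_ideal I \<Longrightarrow> S \<subseteq> I \<Longrightarrow> gen_ideal S \<subseteq> I"
  unfolding gen_ideal_def by blast

lemma radical_superset: "I \<subseteq> radical I"
  unfolding radical_def by (auto intro: exI[of _ 1])

lemma radical_mono: "I \<subseteq> J \<Longrightarrow> radical I \<subseteq> radical J"
  unfolding radical_def by auto

lemma is_ideal_radical:
  assumes I: "is_ideal I"
  shows "is_ideal (radical I)"
  unfolding is_ideal_def
proof (intro conjI ballI allI)
  show "0 \<in> radical I" using is_idealD(1)[OF I] radical_superset by blast
  fix a assume "a \<in> radical I"
  then obtain m where m: "a ^ m \<in> I" by (auto simp: radical_def)
  show "r * a \<in> radical I" for r
    using m I by (auto simp: radical_def power_mult_distrib is_idealD intro!: exI[of _ m])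
  fix b assume "b \<in> radical I"
  then obtain n where n: "b ^ n \<in> I" by (auto simp: radical_def)
  have "(a + b) ^ (m + n) = (\<Sum>k\<le>m + n. of_nat ((m + n) choose k) * a ^ k * b ^ (m + n - k))"
    by (rule binomial_ring)
  also have "\<dots> \<in> I"
  proof (rule is_ideal_sum[OF I])
    fix k
    show "of_nat ((m + n) choose k) * a ^ k * b ^ (m + n - k) \<in> I"
    proof (cases "m \<le> k")
      case True
      then show ?thesis using is_ideal_power_mono[OF I m] by (simp add: is_idealD[OF I])
    next
      case False
      then have "b ^ (m + n - k) \<in> I" by (intro is_ideal_power_mono[OF I n]) auto
      then show ?thesis by (simp add: is_idealD[OF I])
    qed
  qed
  finally show "a + b \<in> radical I" by (auto simp: radical_def)
qed

lemma radical_idem: "radical (radical I) = radical I"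
proof
  show "radical (radical I) \<subseteq> radical I"
    by (auto simp: radical_def power_mult[symmetric])
qed (rule radical_superset)

section \<open>Prime ideals and minimal primes\<close>

lemma is_prime_idealD:
  assumes "is_prime_ideal P"
  shows "is_ideal P" "1 \<notin> P" "\<And>a b. a * b \<in> P \<Longrightarrow> a \<in> P \<or> b \<in> P"
    "\<And>a n. a ^ n \<in> P \<Longrightarrow> a \<in> P"
proof -
  show *: "is_ideal P" "1 \<notin> P" "\<And>a b. a * b \<in> P \<Longrightarrow> a \<in> P \<or> b \<in> P"
    using assms by (auto simp: is_prime_ideal_def)
  show "a ^ n \<in> P \<Longrightarrow> a \<in> P" for a n
    by (induction n) (simp add: *(2), metis *(3) power_Suc)
qed

lemma prime_ideal_prod:
  assumes "is_prime_ideal P" "finite A" "prod f A \<in> P"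
  shows "\<exists>i\<in>A. f i \<in> P"
  using assms(2,3)
  by (induction A rule: finite_induct) (simp add: is_prime_idealD(2)[OF assms(1)],
      metis is_prime_idealD(3)[OF assms(1)] insertI1 insertI2 prod.insert)

lemma radical_prime: "is_prime_ideal P \<Longrightarrow> radical P = P"
  using radical_superset[of P] is_prime_idealD(4)[of P] unfolding radical_def by blast

text \<open>An ideal maximal among those that contain \<open>I\<close> and no power of
  \<open>x\<close> is prime: adjoining an outside element captures a power of \<open>x\<close>, and
  multiplying two such relations would put a power of \<open>x\<close> into the ideal if the product
  of the two outside elements were there.\<close>

lemma exists_prime_ideal_avoiding:
  fixes I :: "'r::comm_ring_1 set"
  assumes I: "is_ideal I" and x: "x \<notin> radical I"
  obtains P where "is_prime_ideal P" "I \<subseteq> P" "x \<notin> P"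
proof -
  define \<A> where "\<A> = {J. is_ideal J \<and> I \<subseteq> J \<and> (\<forall>n. x ^ n \<notin> J)}"
  have "\<exists>M\<in>\<A>. \<forall>X\<in>\<A>. M \<subseteq> X \<longrightarrow> X = M"
  proof (rule subset_Zorn_nonempty)
    show "\<A> \<noteq> {}" using I x by (auto simp: \<A>_def radical_def)
    fix \<C> assume ne: "\<C> \<noteq> {}" and "subset.chain \<A> \<C>"
    then have C: "\<C> \<subseteq> \<A>" "\<And>A B. A \<in> \<C> \<Longrightarrow> B \<in> \<C> \<Longrightarrow> A \<subseteq> B \<or> B \<subseteq> A"
      by (auto simp: subset_chain_def)
    have id: "is_ideal A" if "A \<in> \<C>" for A using C(1) that by (auto simp: \<A>_def)
    have "is_ideal (\<Union>\<C>)"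
      unfolding is_ideal_def
    proof (intro conjI ballI allI)
      show "0 \<in> \<Union>\<C>" using ne id is_idealD(1) by blast
      fix a assume "a \<in> \<Union>\<C>"
      then obtain A where A: "A \<in> \<C>" "a \<in> A" by blast
      show "r * a \<in> \<Union>\<C>" for r using A is_idealD(3)[OF id[OF A(1)]] by blast
      fix b assume "b \<in> \<Union>\<C>"
      then obtain B where B: "B \<in> \<C>" "b \<in> B" by blast
      show "a + b \<in> \<Union>\<C>"
        using C(2)[OF A(1) B(1)]
      proof
        assume "A \<subseteq> B"
        then have "a + b \<in> B" using A B is_idealD(2)[OF id[OF B(1)]] by blast
        then show ?thesis using B by blast
      next
        assume "B \<subseteq> A"
        then have "a + b \<in> A" using A B is_idealD(2)[OF id[OF A(1)]] by blast
        then show ?thesis using A by blast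
      qed
    qed
    then show "\<Union>\<C> \<in> \<A>" using ne C(1) by (fastforce simp: \<A>_def)
  qed
  then obtain M where M: "is_ideal M" "I \<subseteq> M" "\<And>n. x ^ n \<notin> M"
    and max: "\<And>X. X \<in> \<A> \<Longrightarrow> M \<subseteq> X \<Longrightarrow> X = M"
    by (auto simp: \<A>_def)
  have ext: "\<exists>n u. x ^ n - u * a \<in> M" if "a \<notin> M" for a
  proof (rule ccontr)
    assume neg: "\<nexists>n u. x ^ n - u * a \<in> M"
    let ?X = "{m + u * a | m u. m \<in> M}"
    have X: "m + u * a \<in> ?X" if "m \<in> M" for m u using that by blast
    have "is_ideal ?X"
      unfolding is_ideal_def
    proof (intro conjI ballI allI)
      show "0 \<in> ?X" using X[OF is_idealD(1)[OF M(1)], of 0] by simp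
      fix c assume "c \<in> ?X"
      then obtain m u where c: "c = m + u * a" "m \<in> M" by blast
      show "r * c \<in> ?X" for r
        using X[OF is_idealD(3)[OF M(1) c(2)], of r "r * u"] c(1) by (simp add: algebra_simps)
      fix d assume "d \<in> ?X"
      then obtain m' u' where d: "d = m' + u' * a" "m' \<in> M" by blast
      show "c + d \<in> ?X"
        using X[OF is_idealD(2)[OF M(1) c(2) d(2)], of "u + u'"] c(1) d(1) by (simp add: algebra_simps)
    qed
    moreover have "M \<subseteq> ?X" using X[of _ 0] by auto
    moreover have "x ^ n \<notin> ?X" for n
    proof
      assume "x ^ n \<in> ?X"
      then obtain m u where "x ^ n = m + u * a" "m \<in> M" by blast
      then show False using neg by (metis add_diff_cancel_right')
    qed
    ultimately have "?X = M" using M(2) by (intro max) (auto simp: \<A>_def)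
    moreover have "a \<in> ?X" using X[OF is_idealD(1)[OF M(1)], of 1] by simp
    ultimately show False using that by blast
  qed
  have "is_prime_ideal M"
    unfolding is_prime_ideal_def
  proof (intro conjI allI impI)
    show "1 \<notin> M" using M(3)[of 0] by simp
    fix a b assume ab: "a * b \<in> M"
    show "a \<in> M \<or> b \<in> M"
    proof (rule ccontr)
      assume "\<not> (a \<in> M \<or> b \<in> M)"
      then obtain m u n v where "x ^ m - u * a \<in> M" "x ^ n - v * b \<in> M" using ext by metis
      then have "x ^ n * (x ^ m - u * a) + u * a * (x ^ n - v * b) + u * v * (a * b) \<in> M"
        using ab by (intro is_idealD(2)[OF M(1)] is_idealD(3)[OF M(1), of _ "x ^ n"] is_idealD(3)[OF M(1), of _ "u * a"] is_idealD(3)[OF M(1), of _ "u * v"])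
      also have "x ^ n * (x ^ m - u * a) + u * a * (x ^ n - v * b) + u * v * (a * b) = x ^ (m + n)"
        by (simp add: algebra_simps power_add)
      finally show False using M(3) by blast
    qed
  qed (fact M)
  moreover have "x \<notin> M" using M(3)[of 1] by simp
  ultimately show ?thesis using that M(2) by blast
qed

text \<open>The intersection of a chain of primes is prime. Zorn's lemma is applied to complements,
  since the form used here yields maximal elements.\<close>

lemma exists_minimal_prime_subset:
  fixes P :: "'r::comm_ring_1 set"
  assumes P: "is_prime_ideal P"
  obtains Q where "is_minimal_prime Q" "Q \<subseteq> P"
proof -
  define \<A> where "\<A> = {- Q | Q. is_prime_ideal Q \<and> Q \<subseteq> P}"
  have "\<exists>M\<in>\<A>. \<forall>X\<in>\<A>. M \<subseteq> X \<longrightarrow> X = M"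
  proof (rule subset_Zorn_nonempty)
    show "\<A> \<noteq> {}" using P by (auto simp: \<A>_def)
    fix \<C> assume ne: "\<C> \<noteq> {}" and "subset.chain \<A> \<C>"
    then have C: "\<C> \<subseteq> \<A>" "\<And>A B. A \<in> \<C> \<Longrightarrow> B \<in> \<C> \<Longrightarrow> A \<subseteq> B \<or> B \<subseteq> A"
      by (auto simp: subset_chain_def)
    have pr: "is_prime_ideal (- A)" "- A \<subseteq> P" if "A \<in> \<C>" for A
      using C(1) that by (auto simp: \<A>_def)
    define Q where "Q = \<Inter> (uminus ` \<C>)"
    have "is_prime_ideal Q"
      unfolding is_prime_ideal_def
    proof (intro conjI allI impI)
      show "is_ideal Q"
        unfolding is_ideal_def Q_def
        using is_idealD(1-3)[OF is_prime_idealD(1)[OF pr(1)]] by (intro conjI ballI allI INT_I) blast+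
      show "1 \<notin> Q" using ne is_prime_idealD(2)[OF pr(1)] unfolding Q_def by blast
      fix a b assume ab: "a * b \<in> Q"
      show "a \<in> Q \<or> b \<in> Q"
      proof (rule ccontr)
        assume "\<not> (a \<in> Q \<or> b \<in> Q)"
        then obtain A B where AB: "A \<in> \<C>" "B \<in> \<C>" "a \<in> A" "b \<in> B" by (auto simp: Q_def)
        then obtain D where D: "D \<in> \<C>" "a \<in> D" "b \<in> D" using C(2)[OF AB(1,2)] by blast
        have "a * b \<in> - D" using ab D(1) by (auto simp: Q_def)
        then show False using is_prime_idealD(3)[OF pr(1)[OF D(1)]] D by blast
      qed
    qed
    moreover have "Q \<subseteq> P" using ne pr(2) by (auto simp: Q_def)
    moreover have "\<Union>\<C> = - Q" by (auto simp: Q_def)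
    ultimately show "\<Union>\<C> \<in> \<A>" unfolding \<A>_def by blast
  qed
  then obtain M where "M \<in> \<A>" and max: "\<And>X. X \<in> \<A> \<Longrightarrow> M \<subseteq> X \<Longrightarrow> X = M" by metis
  then obtain Q where Q: "is_prime_ideal Q" "Q \<subseteq> P" "M = - Q" by (auto simp: \<A>_def)
  have min: "Q' = Q" if "is_prime_ideal Q'" "Q' \<subseteq> Q" for Q'
  proof -
    have "- Q' \<in> \<A>" using that Q(2) by (auto simp: \<A>_def)
    then have "- Q' = - Q" using max that(2) Q(3) by blast
    then show ?thesis by simp
  qed
  have "is_minimal_prime Q"
    unfolding is_minimal_prime_def using Q(1) min by (metis psubset_eq)
  then show ?thesis using that Q(2) by blast
qed

lemma nilpotent_if_in_all_minimal_primes: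
  fixes x :: "'r::comm_ring_1"
  assumes "\<And>P. is_minimal_prime P \<Longrightarrow> x \<in> P"
  shows "\<exists>n. x ^ n = 0"
proof (rule ccontr)
  assume "\<nexists>n. x ^ n = 0"
  then have "x \<notin> radical {0}" by (auto simp: radical_def)
  moreover have "is_ideal {0 :: 'r}" by (auto simp: is_ideal_def)
  ultimately obtain P where "is_prime_ideal P" "x \<notin> P" by (metis exists_prime_ideal_avoiding)
  then show False using assms by (metis exists_minimal_prime_subset subset_iff)
qed

section \<open>Regular sequences and local cohomology\<close>

text \<open>In the applications \<open>J\<close> is the ideal of multipliers that make a lifting
  problem solvable: solving it after multiplication by powers of the \<open>s t\<close> then solves
  it after multiplication by a power of \<open>x\<close>.\<close>

lemma power_mem_if_radical_gen_ideal:
  assumes J: "is_ideal J" and s: "\<And>t. t \<in> T \<Longrightarrow> \<exists>n. s t ^ n \<in> J"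
    and x: "x \<in> radical (gen_ideal (s ` T))"
  shows "\<exists>n. x ^ n \<in> J"
proof -
  have "gen_ideal (s ` T) \<subseteq> radical J"
    by (rule gen_ideal_subset[OF is_ideal_radical[OF J]]) (use s in \<open>auto simp: radical_def\<close>)
  then have "x \<in> radical J" using x radical_mono radical_idem by blast
  then show ?thesis by (simp add: radical_def)
qed

text \<open>This removes the multiplier supplied by the preceding lemma, once a single factor can be
  cancelled by regularity.\<close>

lemma cancel_power:
  fixes x :: "'a::comm_monoid_mult"
  assumes "\<And>w. P (x * w) \<Longrightarrow> P w"
  shows "P (x ^ n * w) \<Longrightarrow> P w"
proof (induction n)
  case (Suc n)
  then show ?case using assms[of "x ^ n * w"] by (simp add: mult.assoc)
qed simp

lemma is_ideal_CollectI:
  assumes "P 0" "\<And>a b. P a \<Longrightarrow> P b \<Longrightarrow> P (a + b)" "\<And>a c. P a \<Longrightarrow> P (c * a)"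
  shows "is_ideal (Collect P)"
  using assms by (simp add: is_ideal_def)

text \<open>Vanishing of the local cohomology \<open>H\<^sup>1\<close> of R/I, where y, z is a regular sequence modulo I: the
  fractions \<open>g\<^sub>t / s\<^sub>t\<^sup>M\<close> are a section over the union of the D(s t), and the multiples of it that
  come from R/I form an ideal Q with \<open>y w \<in> Q \<Longrightarrow> w \<in> Q\<close>.\<close>

lemma section_extends:
  fixes s g :: "'t \<Rightarrow> 'r::comm_ring_1"
  assumes I: "is_ideal I"
    and y: "\<And>a. y * a \<in> I \<Longrightarrow> a \<in> I"
    and z: "\<And>a i r. z * a = i + y * r \<Longrightarrow> i \<in> I \<Longrightarrow> \<exists>i\<in>I. \<exists>r. a = i + y * r"
    and rad: "y \<in> radical (gen_ideal (s ` T))" "z \<in> radical (gen_ideal (s ` T))"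
    and sec: "\<And>t u. t \<in> T \<Longrightarrow> u \<in> T \<Longrightarrow> s u ^ M * g t - s t ^ M * g u \<in> I"
  shows "\<exists>r M'. \<forall>t\<in>T. s t ^ M' * (g t - r * s t ^ M) \<in> I"
proof -
  note I' = is_idealD[OF I]
  define Q where "Q w \<longleftrightarrow> (\<exists>r M'. \<forall>t\<in>T. s t ^ M' * (w * g t - r * s t ^ M) \<in> I)" for w
  have "is_ideal (Collect Q)"
  proof (rule is_ideal_CollectI)
    show "Q 0" unfolding Q_def using I' by (auto intro!: exI[of _ 0])
    fix a assume "Q a"
    then obtain r M' where r: "\<And>t. t \<in> T \<Longrightarrow> s t ^ M' * (a * g t - r * s t ^ M) \<in> I"
      unfolding Q_def by auto
    show "Q (c * a)" for c
    proof -
      have "s t ^ M' * (c * a * g t - c * r * s t ^ M) \<in> I" if "t \<in> T" for t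
        using I'(3)[OF r[OF that], of c] by (simp add: algebra_simps)
      then show ?thesis unfolding Q_def by blast
    qed
    fix b assume "Q b"
    then obtain r' M'' where r': "\<And>t. t \<in> T \<Longrightarrow> s t ^ M'' * (b * g t - r' * s t ^ M) \<in> I"
      unfolding Q_def by auto
    have "s t ^ (M' + M'') * ((a + b) * g t - (r + r') * s t ^ M) \<in> I" if "t \<in> T" for t
      using I'(2)[OF I'(3)[OF r[OF that], of "s t ^ M''"] I'(3)[OF r'[OF that], of "s t ^ M'"]]
      by (simp add: algebra_simps power_add)
    then show "Q (a + b)" unfolding Q_def by blast
  qed
  moreover have "s v ^ M \<in> Collect Q" if "v \<in> T" for v
  proof -
    \<comment> \<open>The multiple of the section by \<open>s v ^ M\<close> comes from the global
      element \<open>g v\<close>.\<close>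
    have "s t ^ 0 * (s v ^ M * g t - g v * s t ^ M) \<in> I" if "t \<in> T" for t
      using sec[OF that \<open>v \<in> T\<close>] by (simp add: mult.commute)
    then show ?thesis unfolding Q_def by blast
  qed
  ultimately obtain N where N: "Q (y ^ N * 1)"
    using power_mem_if_radical_gen_ideal[OF _ _ rad(1), of "Collect Q"] by auto
  have step: "Q w" if Qyw: "Q (y * w)" for w
  proof -
    obtain r M' where r: "\<And>t. t \<in> T \<Longrightarrow> s t ^ M' * (y * w * g t - r * s t ^ M) \<in> I"
      using Qyw unfolding Q_def by auto
    \<comment> \<open>\<open>K\<close> collects the \<open>a\<close> that carry \<open>r\<close>
      into \<open>I + (y)\<close>. It contains powers of the \<open>s t\<close>, hence a power of
      \<open>z\<close>, and \<open>z\<close> is regular modulo \<open>I + (y)\<close>; so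
      \<open>r\<close> itself has the form \<open>i + y * r'\<close>. Cancelling \<open>y\<close>
      modulo \<open>I\<close> shows that \<open>r'\<close> represents \<open>w\<close> times the
      section.\<close>
    define K where "K a \<longleftrightarrow> (\<exists>i\<in>I. \<exists>r'. a * r = i + y * r')" for a
    have "is_ideal (Collect K)"
    proof (rule is_ideal_CollectI)
      show "K 0" unfolding K_def using I'(1) by (metis add_0 mult_zero_left mult_zero_right)
      fix a assume "K a"
      then obtain i r' where a: "i \<in> I" "a * r = i + y * r'" unfolding K_def by auto
      show "K (c * a)" for c
        unfolding K_def using I'(3)[OF a(1), of c] arg_cong[OF a(2), of "\<lambda>e. c * e"]
        by (intro bexI[of _ "c * i"] exI[of _ "c * r'"]) (simp_all add: algebra_simps)
      fix b assume "K b"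
      then obtain i' r'' where b: "i' \<in> I" "b * r = i' + y * r''" unfolding K_def by auto
      show "K (a + b)"
        unfolding K_def using I'(2)[OF a(1) b(1)] a(2) b(2)
        by (intro bexI[of _ "i + i'"] exI[of _ "r' + r''"]) (simp_all add: algebra_simps)
    qed
    moreover have "s t ^ (M' + M) \<in> Collect K" if "t \<in> T" for t
      unfolding K_def mem_Collect_eq
      by (intro bexI[of _ "- (s t ^ M' * (y * w * g t - r * s t ^ M))"] exI[of _ "s t ^ M' * w * g t"])
        (use I'(5)[OF r[OF that]] in \<open>simp_all add: algebra_simps power_add\<close>)
    ultimately obtain n where n: "K (z ^ n)"
      using power_mem_if_radical_gen_ideal[OF _ _ rad(2), of "Collect K"] by auto
    have "\<exists>i\<in>I. \<exists>r'. r = i + y * r'"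
    proof (rule cancel_power[where P = "\<lambda>a. \<exists>i\<in>I. \<exists>r'. a = i + y * r'" and x = z and n = n])
      show "\<exists>i\<in>I. \<exists>r'. z ^ n * r = i + y * r'" using n by (simp add: K_def)
    qed (use z in blast)
    then obtain i r' where r': "i \<in> I" "r = i + y * r'" by blast
    have "s t ^ M' * (w * g t - r' * s t ^ M) \<in> I" if "t \<in> T" for t
    proof (rule y)
      have "s t ^ M' * (y * w * g t - r * s t ^ M) + s t ^ M' * s t ^ M * i \<in> I"
        by (intro I'(2) I'(3)[OF r'(1)] r that)
      then show "y * (s t ^ M' * (w * g t - r' * s t ^ M)) \<in> I"
        using r'(2) by (simp add: algebra_simps)
    qed
    then show ?thesis unfolding Q_def by blast
  qed
  from cancel_power[of Q, OF step N] show ?thesis by (simp add: Q_def)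
qed

lemma gen_ideal_empty: "gen_ideal {} = {0}"
  using is_idealD(1)[OF is_ideal_gen_ideal, of "{}"] gen_ideal_subset[of "{0}" "{}"]
  by (auto simp: is_ideal_def)

lemma gen_ideal_insert:
  "gen_ideal (insert y S) = {i + y * r | i r. i \<in> gen_ideal S}"
proof
  note I = is_idealD[OF is_ideal_gen_ideal[of S]]
  let ?K = "{i + y * r | i r. i \<in> gen_ideal S}"
  have K: "i + y * r \<in> ?K" if "i \<in> gen_ideal S" for i r using that by blast
  have "is_ideal ?K"
    unfolding is_ideal_def
  proof (intro conjI ballI allI)
    show "0 \<in> ?K" using K[OF I(1), of 0] by simp
    fix c assume "c \<in> ?K"
    then obtain i u where c: "c = i + y * u" "i \<in> gen_ideal S" by blast
    show "r * c \<in> ?K" for r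
      using K[OF I(3)[OF c(2)], of r "r * u"] c(1) by (simp add: algebra_simps)
    fix d assume "d \<in> ?K"
    then obtain i' u' where d: "d = i' + y * u'" "i' \<in> gen_ideal S" by blast
    show "c + d \<in> ?K"
      using K[OF I(2)[OF c(2) d(2)], of "u + u'"] c(1) d(1) by (simp add: algebra_simps)
  qed
  moreover have "insert y S \<subseteq> ?K"
    using K[OF I(1), of 1] K[of _ 0] gen_ideal_superset[of S] by auto
  ultimately show "gen_ideal (insert y S) \<subseteq> ?K" by (rule gen_ideal_subset)
  note J = is_idealD[OF is_ideal_gen_ideal[of "insert y S"]]
  have "gen_ideal S \<subseteq> gen_ideal (insert y S)"
    by (rule gen_ideal_subset[OF is_ideal_gen_ideal]) (use gen_ideal_superset in blast)
  moreover have "y \<in> gen_ideal (insert y S)" using gen_ideal_superset by blast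
  ultimately show "?K \<subseteq> gen_ideal (insert y S)" using J(2,4) by blast
qed

lemma regular_sequence_3E:
  fixes xs :: "'r::comm_ring_1 list"
  assumes "regular_sequence xs" "length xs = 3"
  obtains x y z where "set xs = {x, y, z}"
    "\<And>a. x * a = 0 \<Longrightarrow> a = 0"
    "\<And>a. y * a \<in> gen_ideal {x} \<Longrightarrow> a \<in> gen_ideal {x}"
    "\<And>a. z * a \<in> gen_ideal {y, x} \<Longrightarrow> a \<in> gen_ideal {y, x}"
proof -
  obtain x y z where xs: "xs = [x, y, z]"
    using assms(2) by (auto simp: numeral_3_eq_3 length_Suc_conv)
  have reg: "\<And>i a. i < 3 \<Longrightarrow> xs ! i * a \<in> gen_ideal (set (take i xs)) \<Longrightarrow> a \<in> gen_ideal (set (take i xs))"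
    using assms unfolding regular_sequence_def by auto
  show ?thesis
  proof (rule that)
    show "set xs = {x, y, z}" by (simp add: xs)
    show "x * a = 0 \<Longrightarrow> a = 0" for a using reg[of 0 a] by (simp add: xs gen_ideal_empty)
    show "y * a \<in> gen_ideal {x} \<Longrightarrow> a \<in> gen_ideal {x}" for a using reg[of 1 a] by (simp add: xs)
    show "z * a \<in> gen_ideal {y, x} \<Longrightarrow> a \<in> gen_ideal {y, x}" for a
      using reg[of 2 a] by (simp add: xs numeral_2_eq_2 insert_commute)
  qed
qed

text \<open>Vanishing of the local cohomology \<open>H\<^sup>2\<close> of R: the Cech 1-cocycle b on the cover by the D(s t) is
  the coboundary of the fractions \<open>g\<^sub>t / s\<^sub>t\<^sup>M\<close>. The step from x w to w uses the vanishing of \<open>H\<^sup>1\<close>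
  of R/x.\<close>

lemma cocycle_splits:
  fixes s :: "'t \<Rightarrow> 'r::comm_ring_1" and b :: "'t \<Rightarrow> 't \<Rightarrow> 'r"
  assumes x: "\<And>a. x * a = 0 \<Longrightarrow> a = 0"
    and y: "\<And>a. y * a \<in> gen_ideal {x} \<Longrightarrow> a \<in> gen_ideal {x}"
    and z: "\<And>a. z * a \<in> gen_ideal {y, x} \<Longrightarrow> a \<in> gen_ideal {y, x}"
    and rad: "{x, y, z} \<subseteq> radical (gen_ideal (s ` T))"
    and cocycle: "\<And>t u v. t \<in> T \<Longrightarrow> u \<in> T \<Longrightarrow> v \<in> T \<Longrightarrow>
      (s t * s u * s v) ^ L * (b t u + b u v - b t v) = 0"
  shows "\<exists>M g. \<forall>t\<in>T. \<forall>u\<in>T. s u ^ M * g t - s t ^ M * g u = b t u * s t ^ M * s u ^ M"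
proof -
  define P where "P w \<longleftrightarrow> (\<exists>M g. \<forall>t\<in>T. \<forall>u\<in>T.
    s u ^ M * g t - s t ^ M * g u = w * b t u * s t ^ M * s u ^ M)" for w
  have "is_ideal (Collect P)"
  proof (rule is_ideal_CollectI)
    show "P 0" unfolding P_def by (auto intro!: exI[of _ "\<lambda>_. 0"])
    fix a assume "P a"
    then obtain M g where g: "\<And>t u. t \<in> T \<Longrightarrow> u \<in> T \<Longrightarrow>
        s u ^ M * g t - s t ^ M * g u = a * b t u * s t ^ M * s u ^ M"
      unfolding P_def by auto
    show "P (c * a)" for c
    proof -
      have "s u ^ M * (c * g t) - s t ^ M * (c * g u) = c * a * b t u * s t ^ M * s u ^ M"
        if "t \<in> T" "u \<in> T" for t u
        using arg_cong[OF g[OF that], of "\<lambda>e. c * e"] by (simp add: algebra_simps)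
      then show ?thesis unfolding P_def by (intro exI[of _ M] exI[of _ "\<lambda>t. c * g t"]) blast
    qed
    fix a' assume "P a'"
    then obtain M' g' where g': "\<And>t u. t \<in> T \<Longrightarrow> u \<in> T \<Longrightarrow>
        s u ^ M' * g' t - s t ^ M' * g' u = a' * b t u * s t ^ M' * s u ^ M'"
      unfolding P_def by auto
    have "s u ^ (M + M') * (s t ^ M' * g t + s t ^ M * g' t) - s t ^ (M + M') * (s u ^ M' * g u + s u ^ M * g' u)
        = (a + a') * b t u * s t ^ (M + M') * s u ^ (M + M')"
      if "t \<in> T" "u \<in> T" for t u
    proof -
      have "s u ^ (M + M') * (s t ^ M' * g t + s t ^ M * g' t) - s t ^ (M + M') * (s u ^ M' * g u + s u ^ M * g' u)
        = s t ^ M' * s u ^ M' * (s u ^ M * g t - s t ^ M * g u)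
          + s t ^ M * s u ^ M * (s u ^ M' * g' t - s t ^ M' * g' u)"
        by (simp add: algebra_simps power_add)
      then show ?thesis unfolding g[OF that] g'[OF that] by (simp add: algebra_simps power_add)
    qed
    then show "P (a + a')" unfolding P_def
      by (intro exI[of _ "M + M'"] exI[of _ "\<lambda>t. s t ^ M' * g t + s t ^ M * g' t"]) blast
  qed
  moreover have "s v ^ L \<in> Collect P" if v: "v \<in> T" for v
  proof -
    \<comment> \<open>With \<open>v\<close> fixed, \<open>t\<close> maps to \<open>b t v\<close> is
      a splitting over \<open>D(s v)\<close> by the cocycle condition; the factor
      \<open>s v ^ L\<close> clears what is lost outside.\<close>
    have "s u ^ L * (s t ^ L * s v ^ L * b t v) - s t ^ L * (s u ^ L * s v ^ L * b u v)
        = s v ^ L * b t u * s t ^ L * s u ^ L" if "t \<in> T" "u \<in> T" for t u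
      using cocycle[OF that v] by (simp add: algebra_simps power_mult_distrib)
    then show ?thesis unfolding P_def mem_Collect_eq
      by (intro exI[of _ L] exI[of _ "\<lambda>t. s t ^ L * s v ^ L * b t v"]) blast
  qed
  ultimately obtain N where N: "P (x ^ N * 1)"
    using power_mem_if_radical_gen_ideal[of "Collect P" T s x] rad by auto
  have step: "P w" if Pxw: "P (x * w)" for w
  proof -
    obtain M g where g: "\<And>t u. t \<in> T \<Longrightarrow> u \<in> T \<Longrightarrow>
        s u ^ M * g t - s t ^ M * g u = x * w * b t u * s t ^ M * s u ^ M"
      using Pxw unfolding P_def by auto
    have sx: "gen_ideal {x} = {x * r | r. True}"
      using gen_ideal_insert[of x "{}"] by (auto simp: gen_ideal_empty)
    have yx: "gen_ideal {y, x} = {i + y * r | i r. i \<in> gen_ideal {x}}"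
      by (rule gen_ideal_insert)
    \<comment> \<open>Modulo \<open>x\<close> the right-hand side vanishes, so the fractions agree
      and extend to a global \<open>r\<close>. Subtracting \<open>r\<close> from all of them leaves
      the coboundary unchanged and makes the numerators divisible by \<open>x\<close>; the quotients
      \<open>h t\<close> split \<open>w * b\<close>.\<close>
    have "\<exists>r M'. \<forall>t\<in>T. s t ^ M' * (g t - r * s t ^ M) \<in> gen_ideal {x}"
    proof (rule section_extends[where y = y and z = z])
      show "s u ^ M * g t - s t ^ M * g u \<in> gen_ideal {x}" if "t \<in> T" "u \<in> T" for t u
        unfolding g[OF that] sx by (auto simp: mult.assoc)
      fix a i r assume "z * a = i + y * r" "i \<in> gen_ideal {x}"
      then have "a \<in> gen_ideal {y, x}" by - (rule z, unfold yx, blast)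
      then show "\<exists>i\<in>gen_ideal {x}. \<exists>r. a = i + y * r" unfolding yx by blast
    qed (use rad in \<open>simp_all add: is_ideal_gen_ideal y\<close>)
    then obtain r M' where "\<forall>t\<in>T. \<exists>h. s t ^ M' * (g t - r * s t ^ M) = x * h"
      unfolding sx by blast
    then obtain h where h: "\<And>t. t \<in> T \<Longrightarrow> s t ^ M' * (g t - r * s t ^ M) = x * h t" by metis
    have "s u ^ (M + M') * h t - s t ^ (M + M') * h u = w * b t u * s t ^ (M + M') * s u ^ (M + M')"
      if tu: "t \<in> T" "u \<in> T" for t u
    proof -
      have "x * (s u ^ (M + M') * h t - s t ^ (M + M') * h u)
          = s u ^ (M + M') * (x * h t) - s t ^ (M + M') * (x * h u)" by (simp add: algebra_simps)
      also have "\<dots> = s u ^ M' * s t ^ M' * (s u ^ M * g t - s t ^ M * g u)"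
        unfolding h[OF tu(1), symmetric] h[OF tu(2), symmetric] by (simp add: algebra_simps power_add)
      also have "\<dots> = x * (w * b t u * s t ^ (M + M') * s u ^ (M + M'))"
        unfolding g[OF tu] by (simp add: algebra_simps power_add)
      finally have "x * ((s u ^ (M + M') * h t - s t ^ (M + M') * h u)
          - w * b t u * s t ^ (M + M') * s u ^ (M + M')) = 0" by (simp add: right_diff_distrib)
      from x[OF this] show ?thesis by simp
    qed
    then show ?thesis unfolding P_def by (intro exI[of _ "M + M'"] exI[of _ h]) blast
  qed
  from cancel_power[of P, OF step N] show ?thesis by (simp add: P_def)
qed

section \<open>Homogenized evaluation of polynomials\<close>

locale algebra_map =
  fixes \<phi> :: "'k::field \<Rightarrow> 'r::comm_ring_1"
  assumes add: "\<phi> (a + b) = \<phi> a + \<phi> b"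
    and mult: "\<phi> (a * b) = \<phi> a * \<phi> b"
    and one: "\<phi> 1 = 1"
begin

lemma zero: "\<phi> 0 = 0" using add[of 0 0] by simp

lemma minus: "\<phi> (- a) = - \<phi> a" using add[of a "- a"] zero by (simp add: eq_neg_iff_add_eq_0 add.commute)

lemma diff: "\<phi> (a - b) = \<phi> a - \<phi> b" using add[of a "- b"] minus by simp

lemma power: "\<phi> (a ^ n) = \<phi> a ^ n" by (induction n) (simp_all add: one mult)

lemma of_nat: "\<phi> (of_nat n) = of_nat n" by (induction n) (simp_all add: one zero add)

lemma map_sum: "\<phi> (sum f T) = (\<Sum>t\<in>T. \<phi> (f t))"
  by (induction T rule: infinite_finite_induct) (simp_all add: zero add)

text \<open>Nonzero scalars are units. This turns congruences between scalars modulo a prime into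
  equations in k.\<close>

lemma unit_not_mem:
  assumes "is_ideal I" "1 \<notin> I" "\<phi> a \<in> I"
  shows "a = 0"
proof (rule ccontr)
  assume "a \<noteq> 0"
  then have "\<phi> (inverse a) * \<phi> a = 1" by (simp flip: mult add: one)
  then show False using is_idealD(3)[OF assms(1,3), of "\<phi> (inverse a)"] assms(2) by simp
qed

text \<open>For \<open>degree c \<le> n\<close> this is \<open>s ^ n\<close> times the value of
  \<open>c\<close> at the fraction x/s, written without denominators.\<close>

definition homogenized_eval :: "'k poly \<Rightarrow> nat \<Rightarrow> 'r \<Rightarrow> 'r \<Rightarrow> 'r" where
  "homogenized_eval c n x s = (\<Sum>j\<le>n. \<phi> (coeff c j) * x ^ j * s ^ (n - j))"

lemma homogenized_eval_add:
  "homogenized_eval (c + d) n x s = homogenized_eval c n x s + homogenized_eval d n x s"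
  by (simp add: homogenized_eval_def add algebra_simps sum.distrib)

lemma homogenized_eval_smult: "homogenized_eval (smult a c) n x s = \<phi> a * homogenized_eval c n x s"
  by (simp add: homogenized_eval_def mult sum_distrib_left mult.assoc)

lemma homogenized_eval_pCons:
  "homogenized_eval (pCons a c) (Suc n) x s = \<phi> a * s ^ Suc n + x * homogenized_eval c n x s"
  unfolding homogenized_eval_def sum.atMost_Suc_shift
  by (simp add: sum_distrib_left mult_ac)

lemma homogenized_eval_0: "homogenized_eval 0 n x s = 0"
  by (simp add: homogenized_eval_def zero)

lemma homogenized_eval_1: "homogenized_eval 1 n x s = s ^ n"
proof (cases n)
  case (Suc m)
  then show ?thesis
    using homogenized_eval_pCons[of 1 0 m x s] by (simp add: homogenized_eval_0 one flip: one_pCons)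
qed (simp add: homogenized_eval_def one)

lemma homogenized_eval_const: "homogenized_eval [:a:] n x s = \<phi> a * s ^ n"
  using homogenized_eval_smult[of a 1 n x s] by (simp add: homogenized_eval_1)

text \<open>The degree bounds ensure that no coefficient is cut off; the induction splits off the
  constant coefficient of \<open>c\<close>.\<close>

lemma homogenized_eval_mult:
  assumes "degree c \<le> n" "degree d \<le> m"
  shows "homogenized_eval (c * d) (n + m) x s = homogenized_eval c n x s * homogenized_eval d m x s"
  using assms(1)
proof (induction n arbitrary: c)
  case 0
  then obtain a where c: "c = [:a:]" by (auto elim: degree_eq_zeroE)
  show ?case by (simp add: c homogenized_eval_smult homogenized_eval_const)
next
  case (Suc n)
  obtain a e where c: "c = pCons a e" by (cases c)
  have e: "degree e \<le> n" using Suc.prems by (auto simp: c split: if_splits)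
  \<comment> \<open>Raising the nominal degree by \<open>k\<close> only contributes the factor
    \<open>s ^ k\<close>.\<close>
  have lift: "homogenized_eval d (k + m) x s = s ^ k * homogenized_eval d m x s" for k
  proof -
    have "homogenized_eval d (k + m) x s = (\<Sum>j\<le>m. \<phi> (coeff d j) * x ^ j * s ^ (k + m - j))"
      unfolding homogenized_eval_def
      by (rule sum.mono_neutral_right) (use assms(2) in \<open>auto simp: coeff_eq_0 zero\<close>)
    also have "\<dots> = s ^ k * homogenized_eval d m x s"
      unfolding homogenized_eval_def sum_distrib_left
    proof (intro sum.cong refl)
      fix j assume "j \<in> {..m}"
      then have "s ^ (k + m - j) = s ^ k * s ^ (m - j)" by (simp flip: power_add)
      then show "\<phi> (coeff d j) * x ^ j * s ^ (k + m - j) = s ^ k * (\<phi> (coeff d j) * x ^ j * s ^ (m - j))"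
        by (simp add: mult_ac)
    qed
    finally show ?thesis .
  qed
  have "homogenized_eval (c * d) (Suc n + m) x s
      = \<phi> a * homogenized_eval d (Suc n + m) x s + x * homogenized_eval (e * d) (n + m) x s"
    by (simp add: c homogenized_eval_add homogenized_eval_smult homogenized_eval_pCons zero)
  also have "\<dots> = homogenized_eval c (Suc n) x s * homogenized_eval d m x s"
    unfolding lift Suc.IH[OF e] c homogenized_eval_pCons by (simp add: algebra_simps)
  finally show ?case .
qed

lemma frobenius_exponent_CHAR:
  assumes "CHAR('k) > 0"
  shows "frobenius_exponent TYPE('r) CHAR('k)"
proof -
  have p: "prime CHAR('k)" using assms by (rule prime_CHAR_semidom)
  have "of_nat CHAR('k) = (0 :: 'r)" using of_nat[of "CHAR('k)"] by (simp add: zero)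
  then have "CHAR('r) dvd CHAR('k)" by (simp add: of_nat_eq_0_iff_char_dvd)
  moreover have "CHAR('r) \<noteq> 1" by simp
  ultimately have "CHAR('r) = CHAR('k)" using p by (metis prime_nat_iff)
  then show ?thesis
    unfolding frobenius_exponent_def using p assms freshmans_dream[where ?'a = 'r] by simp
qed

text \<open>The hypothesis on c says that the fraction x/s is a root of c in the fraction field of R/P.\<close>

lemma purely_inseparable_mod_prime:
  assumes sep: "separably_closed TYPE('k)" and P: "is_prime_ideal P"
    and "s \<notin> P" "c \<noteq> 0" "degree c \<le> n" "homogenized_eval c n x s \<in> P"
  shows "\<exists>q \<alpha>. frobenius_exponent TYPE('r) q \<and> x ^ q - \<phi> \<alpha> * s ^ q \<in> P"
  using assms(3-)
proof (induction "degree c" arbitrary: c n x s rule: less_induct)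
  case less
  note PD = is_prime_idealD[OF P]
  \<comment> \<open>The nominal degree is lowered from \<open>n\<close> to \<open>degree c\<close>;
    the surplus power of \<open>s\<close> cancels because \<open>s \<notin> P\<close>.\<close>
  have "homogenized_eval c (degree c + (n - degree c)) x s
      = homogenized_eval c (degree c) x s * s ^ (n - degree c)"
    using homogenized_eval_mult[of c "degree c" 1 "n - degree c" x s] by (simp add: homogenized_eval_1)
  then have c: "homogenized_eval c (degree c) x s \<in> P"
    using less.prems PD(3,4) by (metis le_add_diff_inverse)
  \<comment> \<open>Modulo the prime \<open>P\<close> the fraction is a root of one of two proper
    factors, to which the induction hypothesis applies.\<close>
  have factor: ?case if "c = d * e" "degree d < degree c" "degree e < degree c" for d e
  proof -
    have "d \<noteq> 0" "e \<noteq> 0" using that(1) less.prems(2) by auto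
    then have "homogenized_eval d (degree d) x s \<in> P \<or> homogenized_eval e (degree e) x s \<in> P"
      using c PD(3) homogenized_eval_mult[of d "degree d" e "degree e" x s] that(1)
      by (simp add: degree_mult_eq)
    then show ?thesis
      using less.hyps[OF that(2) less.prems(1) \<open>d \<noteq> 0\<close> order.refl]
        less.hyps[OF that(3) less.prems(1) \<open>e \<noteq> 0\<close> order.refl] by blast
  qed
  show ?case
  proof (cases "degree c = 0")
    case True
    then obtain a where a: "c = [:a:]" by (auto elim: degree_eq_zeroE)
    then have "\<phi> a \<in> P" using c by (simp add: homogenized_eval_const)
    then show ?thesis using unit_not_mem[OF PD(1,2)] a less.prems(2) by simp
  next
    case deg: False
    show ?thesis
    proof (cases "pderiv c = 0")
      case True
      \<comment> \<open>Now \<open>c\<close> is a polynomial \<open>d\<close> in the p-th power of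
        the variable, with \<open>p\<close> the characteristic. So the p-th power of x/s is a root
        of \<open>d\<close>, whose degree is smaller, and the exponent found for it is multiplied by
        \<open>p\<close>.\<close>
      define p where "p = CHAR('k)"
      have dvd: "p dvd j" if "coeff c j \<noteq> 0" for j
      proof (cases j)
        case (Suc i)
        have "of_nat (Suc i) * coeff c (Suc i) = 0"
          using True coeff_pderiv[of c i] by simp
        then show ?thesis
          using that Suc by (simp add: p_def of_nat_eq_0_iff_char_dvd del: of_nat_Suc)
      qed simp
      then have "p dvd degree c" using less.prems(2) by simp
      then obtain m where m: "degree c = p * m" by (elim dvdE)
      then have "p > 0" "m > 0" using deg by (auto intro: gr0I)
      then have p: "frobenius_exponent TYPE('r) p"
        using frobenius_exponent_CHAR \<open>p > 0\<close> unfolding p_def by blast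
      then have "p \<noteq> 1" using prime_CHAR_semidom[where ?'a = 'k] \<open>p > 0\<close> unfolding p_def by auto
      define d where "d = (\<Sum>i\<le>m. monom (coeff c (p * i)) i)"
      have coeff_d: "coeff d i = (if i \<le> m then coeff c (p * i) else 0)" for i
        by (simp add: d_def coeff_sum)
      have "d \<noteq> 0"
        using less.prems(2) coeff_d[of m] m by (metis coeff_0 leading_coeff_neq_0 order.refl)
      have deg_d: "degree d \<le> m" by (rule degree_le) (simp add: coeff_d)
      have "homogenized_eval c (degree c) x s
          = (\<Sum>j\<in>(\<lambda>i. p * i) ` {..m}. \<phi> (coeff c j) * x ^ j * s ^ (degree c - j))"
        unfolding homogenized_eval_def
      proof (rule sum.mono_neutral_right)
        show "\<forall>j\<in>{..degree c} - (\<lambda>i. p * i) ` {..m}. \<phi> (coeff c j) * x ^ j * s ^ (degree c - j) = 0"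
        proof
          fix j assume j: "j \<in> {..degree c} - (\<lambda>i. p * i) ` {..m}"
          have "\<not> p dvd j" using j \<open>p > 0\<close> by (auto simp: m)
          then have "coeff c j = 0" using dvd by blast
          then show "\<phi> (coeff c j) * x ^ j * s ^ (degree c - j) = 0" by (simp add: zero)
        qed
      qed (use m in auto)
      also have "\<dots> = homogenized_eval d m (x ^ p) (s ^ p)"
        unfolding homogenized_eval_def
        by (subst sum.reindex)
          (use \<open>p > 0\<close> in \<open>auto simp: inj_on_def coeff_d m power_mult right_diff_distrib' intro!: sum.cong simp flip: power_mult\<close>)
      finally have d: "homogenized_eval d m (x ^ p) (s ^ p) \<in> P" using c by simp
      have "m < degree c" using m \<open>p > 0\<close> \<open>p \<noteq> 1\<close> \<open>m > 0\<close> by simp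
      then have "degree d < degree c" using deg_d by simp
      moreover have "s ^ p \<notin> P" using less.prems(1) PD(4) by blast
      ultimately obtain q \<alpha> where "frobenius_exponent TYPE('r) q" "(x ^ p) ^ q - \<phi> \<alpha> * (s ^ p) ^ q \<in> P"
        using less.hyps[OF _ _ \<open>d \<noteq> 0\<close> deg_d d] by blast
      then show ?thesis
        using frobenius_exponent_mult[OF p] by (auto simp flip: power_mult)
    next
      case False
      show ?thesis
      proof (cases "coprime c (pderiv c)")
        case True
        \<comment> \<open>Separable closedness supplies a root \<open>r\<close>; modulo
          \<open>P\<close> the fraction equals \<open>r\<close> or is a root of the cofactor
          \<open>e\<close>.\<close>
        then obtain r where "poly c r = 0" using sep deg unfolding separably_closed_def by fastforce
        then obtain e where e: "c = [:- r, 1:] * e" by (metis poly_eq_0_iff_dvd dvdE)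
        then have "e \<noteq> 0" using less.prems(2) by auto
        then have dc: "degree c = 1 + degree e" unfolding e by (subst degree_mult_eq) auto
        then have "homogenized_eval [:- r, 1:] 1 x s * homogenized_eval e (degree e) x s \<in> P"
          using c homogenized_eval_mult[of "[:- r, 1:]" 1 e "degree e" x s] e by simp
        moreover have "homogenized_eval [:- r, 1:] 1 x s = x - \<phi> r * s"
          using homogenized_eval_pCons[of "- r" "[:1:]" 0 x s]
          by (simp add: homogenized_eval_const minus one)
        ultimately have "x - \<phi> r * s \<in> P \<or> homogenized_eval e (degree e) x s \<in> P"
          using PD(3) by metis
        then show ?thesis
        proof
          assume "x - \<phi> r * s \<in> P"
          then show ?thesis using frobenius_exponent_1 by (metis power_one_right)
        next
          assume "homogenized_eval e (degree e) x s \<in> P"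
          then show ?thesis using less.hyps[of e s "degree e" x] less.prems(1) \<open>e \<noteq> 0\<close> dc by simp
        qed
      next
        case False
        \<comment> \<open>A nonconstant common divisor of \<open>c\<close> and its nonzero
          derivative has degree below that of \<open>c\<close>, so it is a proper factor.\<close>
        then obtain g where g: "g dvd c" "g dvd pderiv c" "\<not> is_unit g" by (rule not_coprimeE)
        then obtain h where h: "c = g * h" by (auto elim: dvdE)
        have "g \<noteq> 0" "h \<noteq> 0" using h less.prems(2) by auto
        have "degree g > 0" using g(3) \<open>g \<noteq> 0\<close> by (simp add: is_unit_iff_degree)
        moreover have "degree g \<le> degree (pderiv c)" using g(2) \<open>pderiv c \<noteq> 0\<close> by (rule dvd_imp_degree_le)
        moreover have "degree (pderiv c) \<le> degree c - 1"
          by (rule degree_le) (simp add: coeff_pderiv coeff_eq_0)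
        moreover have "degree c = degree g + degree h"
          using \<open>g \<noteq> 0\<close> \<open>h \<noteq> 0\<close> unfolding h by (rule degree_mult_eq)
        ultimately show ?thesis using deg by (intro factor[OF h]) auto
      qed
    qed
  qed
qed

end

section \<open>Graded algebras\<close>

text \<open>Gaussian elimination: a pivot vector \<open>i\<close> clears coordinate \<open>x\<close>
  from the others, leaving one vector and one coordinate fewer. The coefficient of the pivot is
  chosen afterwards to cancel coordinate \<open>x\<close>.\<close>

lemma exists_linear_dependence:
  fixes M :: "'j \<Rightarrow> 'x \<Rightarrow> 'k::field"
  assumes "finite X" "finite J" "card X < card J"
  shows "\<exists>c. (\<exists>j\<in>J. c j \<noteq> 0) \<and> (\<forall>x\<in>X. (\<Sum>j\<in>J. c j * M j x) = 0)"
  using assms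
proof (induction X arbitrary: J M rule: finite_induct)
  case empty
  then obtain j where "j \<in> J" by fastforce
  then show ?case by (intro exI[of _ "\<lambda>_. 1"]) auto
next
  case (insert x X)
  show ?case
  proof (cases "\<forall>j\<in>J. M j x = 0")
    case True
    then show ?thesis using insert.IH[OF insert.prems(1), of M] insert.prems(2) insert.hyps by auto
  next
    case False
    then obtain i where i: "i \<in> J" "M i x \<noteq> 0" by blast
    define J' where "J' = J - {i}"
    have J': "finite J'" "card X < card J'" "J = insert i J'" "i \<notin> J'"
      using insert.prems insert.hyps i(1) by (auto simp: J'_def)
    obtain c where c: "\<exists>j\<in>J'. c j \<noteq> 0"
        "\<And>y. y \<in> X \<Longrightarrow> (\<Sum>j\<in>J'. c j * (M j y - M j x / M i x * M i y)) = 0"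
      using insert.IH[OF J'(1,2), of "\<lambda>j y. M j y - M j x / M i x * M i y"] by blast
    define c' where "c' = c(i := - (\<Sum>j\<in>J'. c j * M j x) / M i x)"
    have "(\<Sum>j\<in>J. c' j * M j y) = (\<Sum>j\<in>J'. c j * (M j y - M j x / M i x * M i y))" for y
    proof -
      have "(\<Sum>j\<in>J'. c' j * M j y) = (\<Sum>j\<in>J'. c j * M j y)"
        by (intro sum.cong) (use J'(4) in \<open>auto simp: c'_def\<close>)
      then have "(\<Sum>j\<in>J. c' j * M j y) = (\<Sum>j\<in>J'. c j * M j y) - (\<Sum>j\<in>J'. c j * M j x) / M i x * M i y"
        using J' by (simp add: c'_def)
      then show ?thesis
        by (simp add: right_diff_distrib sum_subtractf sum_distrib_right sum_divide_distrib mult.assoc)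
    qed
    moreover have "(\<Sum>j\<in>J'. c j * (M j x - M j x / M i x * M i x)) = 0" using i(2) by simp
    ultimately have "\<forall>y\<in>insert x X. (\<Sum>j\<in>J. c' j * M j y) = 0" using c(2) by auto
    moreover have "\<exists>j\<in>J. c' j \<noteq> 0" using c(1) J' by (auto simp: c'_def)
    ultimately show ?thesis by blast
  qed
qed

lemma gen_ideal_image_finite:
  assumes "finite T" "x \<in> gen_ideal (s ` T)"
  shows "\<exists>a. x = (\<Sum>t\<in>T. s t * a t)"
proof -
  let ?K = "{x. \<exists>a. x = (\<Sum>t\<in>T. s t * a t)}"
  have "is_ideal ?K"
  proof (rule is_ideal_CollectI)
    show "\<exists>a. 0 = (\<Sum>t\<in>T. s t * a t)" by (intro exI[of _ "\<lambda>_. 0"]) simp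
    fix x assume "\<exists>a. x = (\<Sum>t\<in>T. s t * a t)"
    then obtain a where a: "x = (\<Sum>t\<in>T. s t * a t)" by blast
    show "\<exists>a. c * x = (\<Sum>t\<in>T. s t * a t)" for c
      by (intro exI[of _ "\<lambda>t. c * a t"]) (simp add: a sum_distrib_left mult.left_commute)
    fix y assume "\<exists>a. y = (\<Sum>t\<in>T. s t * a t)"
    then obtain b where b: "y = (\<Sum>t\<in>T. s t * b t)" by blast
    show "\<exists>a. x + y = (\<Sum>t\<in>T. s t * a t)"
      by (intro exI[of _ "\<lambda>t. a t + b t"]) (simp add: a b distrib_left sum.distrib)
  qed
  moreover have "s ` T \<subseteq> ?K"
  proof
    fix y assume "y \<in> s ` T"
    then obtain t where t: "t \<in> T" "y = s t" by blast
    have "y = (\<Sum>u\<in>T. s u * (if u = t then 1 else 0))"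
      using t assms(1) by (simp add: if_distrib[of "\<lambda>u. _ * u"] cong: if_cong)
    then show "y \<in> ?K" by (intro CollectI exI)
  qed
  ultimately show ?thesis using gen_ideal_subset assms(2) by blast
qed

locale graded = algebra_map \<phi> for \<phi> :: "'k::field \<Rightarrow> 'r::comm_ring_1" +
  fixes gr :: "nat \<Rightarrow> 'r set"
  assumes graded: "graded_algebra \<phi> gr"
begin

lemma gr_0: "0 \<in> gr i"
  and gr_add: "x \<in> gr i \<Longrightarrow> y \<in> gr i \<Longrightarrow> x + y \<in> gr i"
  and gr_scale: "x \<in> gr i \<Longrightarrow> \<phi> a * x \<in> gr i"
  and gr_mult: "x \<in> gr i \<Longrightarrow> y \<in> gr j \<Longrightarrow> x * y \<in> gr (i + j)"
  using graded unfolding graded_algebra_def by auto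

lemma gr_minus: "x \<in> gr i \<Longrightarrow> - x \<in> gr i"
  using gr_scale[of x i "- 1"] by (simp add: minus one)

lemma gr_diff: "x \<in> gr i \<Longrightarrow> y \<in> gr i \<Longrightarrow> x - y \<in> gr i"
  using gr_add gr_minus by (metis add_uminus_conv_diff)

lemma gr_sum: "(\<And>t. t \<in> T \<Longrightarrow> f t \<in> gr i) \<Longrightarrow> sum f T \<in> gr i"
  by (induction T rule: infinite_finite_induct) (auto simp: gr_0 gr_add)

lemma decomposition_unique:
  assumes "\<And>i. coeff p i \<in> gr i" "poly p 1 = 0"
  shows "p = 0"
proof -
  have "(\<Sum>i\<le>degree p. coeff p i) = 0" using assms(2) by (simp add: poly_altdef)
  moreover have "\<forall>N c. (\<forall>i. c i \<in> gr i) \<and> (\<Sum>i\<le>N. c i) = 0 \<longrightarrow> (\<forall>i\<le>N. c i = 0)"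
    using graded unfolding graded_algebra_def by blast
  ultimately have "\<forall>i\<le>degree p. coeff p i = 0" using assms(1) by blast
  then show ?thesis by (metis leading_coeff_neq_0 order.refl)
qed

text \<open>The components are stored as coefficients of a polynomial over R with value
  \<open>r\<close> at 1. The map is then a ring homomorphism into R[X], so that components of
  products are coefficients of products.\<close>

definition decomposition :: "'r \<Rightarrow> 'r poly" where
  "decomposition r = (THE p. (\<forall>i. coeff p i \<in> gr i) \<and> poly p 1 = r)"

abbreviation component :: "nat \<Rightarrow> 'r \<Rightarrow> 'r" where
  "component i r \<equiv> coeff (decomposition r) i"

lemma decomposition_eqI:
  assumes "\<And>i. coeff p i \<in> gr i" "poly p 1 = r"
  shows "decomposition r = p"
  unfolding decomposition_def
proof (rule the_equality)
  fix q assume q: "(\<forall>i. coeff q i \<in> gr i) \<and> poly q 1 = r"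
  have "q - p = 0" by (rule decomposition_unique) (use assms q gr_diff in auto)
  then show "q = p" by simp
qed (use assms in auto)

lemma component_mem: "component i r \<in> gr i"
  and poly_decomposition: "poly (decomposition r) 1 = r"
proof -
  obtain N c where c: "\<And>i. c i \<in> gr i" "r = (\<Sum>i\<le>N. c i)"
    using graded unfolding graded_algebra_def by metis
  have *: "coeff (\<Sum>i\<le>N. monom (c i) i) i \<in> gr i" for i
    using c(1) gr_0 by (auto simp: coeff_sum)
  have "decomposition r = (\<Sum>i\<le>N. monom (c i) i)"
    by (rule decomposition_eqI) (use * c in \<open>auto simp: poly_sum poly_monom\<close>)
  then show "component i r \<in> gr i" "poly (decomposition r) 1 = r"
    using * c(2) by (auto simp: poly_sum poly_monom)
qed

lemma sum_components: "r = (\<Sum>i\<le>degree (decomposition r). component i r)"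
  using poly_decomposition[of r] by (simp add: poly_altdef)

lemma decomposition_add: "decomposition (a + b) = decomposition a + decomposition b"
  by (rule decomposition_eqI) (simp_all add: component_mem gr_add poly_decomposition)

lemma decomposition_mult: "decomposition (a * b) = decomposition a * decomposition b"
proof (rule decomposition_eqI)
  fix i
  show "coeff (decomposition a * decomposition b) i \<in> gr i"
    unfolding coeff_mult
  proof (rule gr_sum)
    fix j assume "j \<in> {..i}"
    then show "component j a * component (i - j) b \<in> gr i"
      using gr_mult[OF component_mem[of a j] component_mem[of b "i - j"]] by simp
  qed
qed (simp add: poly_decomposition)

lemma decomposition_homogeneous: "r \<in> gr i \<Longrightarrow> decomposition r = monom r i"
  by (rule decomposition_eqI) (auto simp: gr_0 poly_monom)

lemma component_homogeneous: "r \<in> gr i \<Longrightarrow> component j r = (if i = j then r else 0)"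
  by (simp add: decomposition_homogeneous)

lemma component_mult_homogeneous:
  "s \<in> gr d \<Longrightarrow> component i (s * r) = (if d \<le> i then s * component (i - d) r else 0)"
  by (simp add: decomposition_mult decomposition_homogeneous coeff_monom_mult)

lemma component_sum: "component i (sum f T) = (\<Sum>t\<in>T. component i (f t))"
  by (induction T rule: infinite_finite_induct)
    (simp_all add: decomposition_add component_homogeneous[OF gr_0[of 0]])

lemma component_diff: "component i (a - b) = component i a - component i b"
  using decomposition_add[of "a - b" b] by (simp add: algebra_simps)

lemma irrelevant_ideal_eq: "irrelevant_ideal gr = {r. component 0 r = 0}"
proof (intro equalityI subsetI CollectI)
  fix r assume "r \<in> irrelevant_ideal gr"
  then obtain N c where c: "\<And>i. c i \<in> gr i" "c 0 = 0" "r = (\<Sum>i\<le>N. c i)"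
    unfolding irrelevant_ideal_def by blast
  then show "component 0 r = 0"
    using component_homogeneous[OF c(1)] by (simp add: component_sum)
next
  fix r assume "r \<in> {r. component 0 r = 0}"
  then show "r \<in> irrelevant_ideal gr"
    unfolding irrelevant_ideal_def using component_mem sum_components[of r] by blast
qed

text \<open>The elements with all components in \<open>P\<close> form a prime ideal inside
  \<open>P\<close>, which by minimality is all of \<open>P\<close>.\<close>

lemma minimal_prime_homogeneous:
  assumes "is_minimal_prime P" "r \<in> P"
  shows "component i r \<in> P"
proof -
  have P: "is_prime_ideal P" using assms(1) by (simp add: is_minimal_prime_def)
  note I = is_idealD[OF is_prime_idealD(1)[OF P]]
  define Q where "Q = {r. \<forall>i. component i r \<in> P}"
  have "Q \<subseteq> P"
  proof
    fix r assume "r \<in> Q"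
    then have "(\<Sum>i\<le>degree (decomposition r). component i r) \<in> P"
      by (intro is_ideal_sum[OF is_prime_idealD(1)[OF P]]) (simp add: Q_def)
    then show "r \<in> P" using sum_components[of r] by simp
  qed
  moreover have "is_prime_ideal Q"
    unfolding is_prime_ideal_def
  proof (intro conjI allI impI)
    show "is_ideal Q"
      unfolding Q_def
    proof (rule is_ideal_CollectI)
      show "\<forall>i. component i 0 \<in> P" using component_homogeneous[OF gr_0] I(1) by simp
      fix a b assume a: "\<forall>i. component i a \<in> P"
      show "\<forall>i. component i (c * a) \<in> P" for c
        unfolding decomposition_mult coeff_mult
        using a by (intro allI is_ideal_sum[OF is_prime_idealD(1)[OF P]] I(3)) auto
      assume "\<forall>i. component i b \<in> P"
      then show "\<forall>i. component i (a + b) \<in> P" using a I(2) by (simp add: decomposition_add)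
    qed
    show "1 \<notin> Q" using \<open>Q \<subseteq> P\<close> is_prime_idealD(2)[OF P] by blast
    fix a b assume ab: "a * b \<in> Q"
    show "a \<in> Q \<or> b \<in> Q"
    proof (rule ccontr)
      assume "\<not> (a \<in> Q \<or> b \<in> Q)"
      then have ex: "\<exists>i. component i a \<notin> P" "\<exists>j. component j b \<notin> P" by (auto simp: Q_def)
      \<comment> \<open>In the lowest degrees \<open>i\<close>, \<open>j\<close> with components
        outside \<open>P\<close>, the component of \<open>a * b\<close> in degree
        \<open>i + j\<close> is the product of these two modulo \<open>P\<close>.\<close>
      define i where "i = (LEAST i. component i a \<notin> P)"
      define j where "j = (LEAST j. component j b \<notin> P)"
      have i: "component i a \<notin> P" "\<And>k. k < i \<Longrightarrow> component k a \<in> P"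
        using LeastI_ex[OF ex(1)] not_less_Least unfolding i_def by blast+
      have j: "component j b \<notin> P" "\<And>k. k < j \<Longrightarrow> component k b \<in> P"
        using LeastI_ex[OF ex(2)] not_less_Least unfolding j_def by blast+
      have "component (i + j) (a * b)
          = component i a * component j b + (\<Sum>k\<in>{..i + j} - {i}. component k a * component (i + j - k) b)"
        unfolding decomposition_mult coeff_mult by (subst sum.remove[of _ i]) auto
      moreover have "(\<Sum>k\<in>{..i + j} - {i}. component k a * component (i + j - k) b) \<in> P"
      proof (rule is_ideal_sum[OF is_prime_idealD(1)[OF P]])
        fix k assume k: "k \<in> {..i + j} - {i}"
        show "component k a * component (i + j - k) b \<in> P"
        proof (cases "k < i")
          case True
          then show ?thesis using i(2) I(4) by blast
        next
          case False
          then have "i + j - k < j" using k by auto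
          then show ?thesis using j(2) I(3) by blast
        qed
      qed
      moreover have "component (i + j) (a * b) \<in> P" using ab by (simp add: Q_def)
      ultimately have "component i a * component j b \<in> P" using I(6) by (metis add_diff_cancel_right')
      then show False using is_prime_idealD(3)[OF P] i(1) j(1) by blast
    qed
  qed
  ultimately have "Q = P" using assms(1) unfolding is_minimal_prime_def by (metis psubset_eq)
  then show ?thesis using assms(2) by (auto simp: Q_def)
qed

end

section \<open>Standard graded algebras\<close>

locale std_graded = graded \<phi> gr for \<phi> :: "'k::field \<Rightarrow> 'r::comm_ring_1" and gr +
  fixes G :: "'r set"
  assumes gr_zero: "gr 0 = range \<phi>"
    and finite_G: "finite G" and G_gr: "G \<subseteq> gr 1" and alg_gen: "r \<in> alg_gen \<phi> G"
begin

abbreviation \<mm> :: "'r set" where "\<mm> \<equiv> irrelevant_ideal gr"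

lemma prime_irrelevant_ideal: "is_prime_ideal \<mm>"
proof -
  have *: "is_ideal \<mm>"
    unfolding irrelevant_ideal_eq
    by (rule is_ideal_CollectI)
      (simp_all add: decomposition_add decomposition_mult coeff_mult component_homogeneous[OF gr_0[of 0]])
  show ?thesis
    unfolding is_prime_ideal_def
  proof (intro conjI allI impI)
    show "is_ideal \<mm>" by (fact *)
    have "1 \<in> gr 0" using one gr_zero by (metis rangeI)
    then show "1 \<notin> \<mm>" by (simp add: irrelevant_ideal_eq component_homogeneous)
    fix a b assume "a * b \<in> \<mm>"
    then have ab: "component 0 a * component 0 b = 0"
      by (simp add: irrelevant_ideal_eq decomposition_mult coeff_mult)
    obtain \<alpha> \<beta> where \<alpha>\<beta>: "component 0 a = \<phi> \<alpha>" "component 0 b = \<phi> \<beta>"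
      using component_mem[of a 0] component_mem[of b 0] gr_zero by auto
    then have "\<phi> (\<alpha> * \<beta>) \<in> {0}" using ab by (simp add: mult)
    then have "\<alpha> * \<beta> = 0" by (rule unit_not_mem[rotated 2]) (auto simp: is_ideal_def)
    then show "a \<in> \<mm> \<or> b \<in> \<mm>" using \<alpha>\<beta> by (auto simp: irrelevant_ideal_eq zero)
  qed
qed

text \<open>By homogeneity \<open>P\<close> contains the component of degree 0, which is a scalar
  and therefore zero.\<close>

lemma minimal_prime_subset_irrelevant_ideal:
  assumes "is_minimal_prime P"
  shows "P \<subseteq> \<mm>"
proof
  fix r assume "r \<in> P"
  then have "component 0 r \<in> P" by (rule minimal_prime_homogeneous[OF assms])
  moreover obtain a where a: "component 0 r = \<phi> a" using component_mem[of r 0] gr_zero by auto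
  moreover have "is_prime_ideal P" using assms by (simp add: is_minimal_prime_def)
  ultimately have "a = 0" using unit_not_mem is_prime_idealD(1,2) by metis
  then show "r \<in> \<mm>" using a by (simp add: irrelevant_ideal_eq zero)
qed

lemma gr_pos_subset_irrelevant_ideal: "d > 0 \<Longrightarrow> gr d \<subseteq> \<mm>"
  by (auto simp: irrelevant_ideal_eq component_homogeneous)

lemma G_subset_irrelevant_ideal: "G \<subseteq> \<mm>"
  using G_gr gr_pos_subset_irrelevant_ideal[of 1] by auto

lemma gr_power: "x \<in> gr d \<Longrightarrow> x ^ i \<in> gr (d * i)"
proof (induction i)
  case 0
  show ?case using gr_zero one by (metis mult_0_right power_0 rangeI)
next
  case (Suc i)
  then show ?case using gr_mult[of x d "x ^ i" "d * i"] by simp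
qed

lemma G_power: "g \<in> G \<Longrightarrow> g ^ i \<in> gr i"
  using gr_power[of g 1 i] G_gr by auto

text \<open>Every element is a scalar plus a member of the ideal generated by \<open>G\<close>, by
  induction over its construction; in \<open>\<mm>\<close> the scalar must vanish.\<close>

lemma irrelevant_ideal_subset:
  assumes I: "is_ideal I" and "G \<subseteq> I"
  shows "\<mm> \<subseteq> I"
proof
  fix r assume r: "r \<in> \<mm>"
  note m = is_idealD[OF is_prime_idealD(1)[OF prime_irrelevant_ideal]]
  \<comment> \<open>The cases \<open>add\<close> and \<open>mult\<close> of the induction hide the
    locale facts of the same names.\<close>
  note hom_add = add and hom_mult = mult
  have "\<exists>a. r - \<phi> a \<in> gen_ideal G"
    using alg_gen[of r]
  proof induction
    case (const a)
    then show ?case using is_idealD(1)[OF is_ideal_gen_ideal] by (intro exI[of _ a]) simp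
  next
    case (gen g)
    then show ?case using gen_ideal_superset by (intro exI[of _ 0]) (auto simp: zero)
  next
    case (add x y)
    then obtain a b where "x - \<phi> a \<in> gen_ideal G" "y - \<phi> b \<in> gen_ideal G" by blast
    from is_idealD(2)[OF is_ideal_gen_ideal this] show ?case
      by (intro exI[of _ "a + b"]) (simp add: hom_add algebra_simps)
  next
    case (mult x y)
    then obtain a b where "x - \<phi> a \<in> gen_ideal G" "y - \<phi> b \<in> gen_ideal G" by blast
    then have "(x - \<phi> a) * y + \<phi> a * (y - \<phi> b) \<in> gen_ideal G"
      using is_idealD(2-4)[OF is_ideal_gen_ideal[of G]] by blast
    then show ?case
      by (intro exI[of _ "a * b"]) (simp add: hom_mult algebra_simps)
  qed
  then obtain a where a: "r - \<phi> a \<in> gen_ideal G" by blast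
  have "gen_ideal G \<subseteq> \<mm>"
    using gen_ideal_subset G_subset_irrelevant_ideal is_prime_idealD(1)[OF prime_irrelevant_ideal] by blast
  then have "r - (r - \<phi> a) \<in> \<mm>" using a r m(6) by blast
  then have "\<phi> a \<in> \<mm>" by simp
  then have "a = 0" using unit_not_mem[OF is_prime_idealD(1,2)[OF prime_irrelevant_ideal]] by blast
  then show "r \<in> I" using a gen_ideal_subset[OF assms] by (auto simp: zero)
qed

lemma gr_Suc:
  assumes "r \<in> gr (Suc d)"
  shows "\<exists>a. (\<forall>g\<in>G. a g \<in> gr d) \<and> r = (\<Sum>g\<in>G. g * a g)"
proof -
  have "r \<in> gen_ideal (id ` G)"
    using assms gr_pos_subset_irrelevant_ideal[of "Suc d"]
      irrelevant_ideal_subset[OF is_ideal_gen_ideal gen_ideal_superset] by auto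
  then obtain a where a: "r = (\<Sum>g\<in>G. g * a g)"
    using gen_ideal_image_finite[OF finite_G] by (metis (no_types, lifting) id_apply sum.cong)
  have "r = component (Suc d) r" using assms by (simp add: component_homogeneous)
  also have "\<dots> = (\<Sum>g\<in>G. component (Suc d) (g * a g))" using a component_sum by metis
  also have "\<dots> = (\<Sum>g\<in>G. g * component d (a g))"
    using G_gr by (intro sum.cong refl) (subst component_mult_homogeneous[of _ 1], auto)
  finally have "r = (\<Sum>g\<in>G. g * component d (a g))" .
  then show ?thesis by (intro exI[of _ "\<lambda>g. component d (a g)"]) (use component_mem in blast)
qed

lemma gr_finitely_spanned:
  "\<exists>B. finite B \<and> (\<forall>r\<in>gr d. \<exists>c. r = (\<Sum>b\<in>B. \<phi> (c b) * b))"
proof (induction d)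
  case 0
  show ?case by (intro exI[of _ "{1}"]) (auto simp: gr_zero)
next
  case (Suc d)
  then obtain B where B: "finite B" "\<And>r. r \<in> gr d \<Longrightarrow> \<exists>c. r = (\<Sum>b\<in>B. \<phi> (c b) * b)" by blast
  define m where "m = (\<lambda>(g, b). g * b :: 'r)"
  define B' where "B' = m ` (G \<times> B)"
  have "\<exists>c. r = (\<Sum>b\<in>B'. \<phi> (c b) * b)" if "r \<in> gr (Suc d)" for r
  proof -
    obtain a where a: "\<And>g. g \<in> G \<Longrightarrow> a g \<in> gr d" "r = (\<Sum>g\<in>G. g * a g)" using gr_Suc[OF \<open>r \<in> gr (Suc d)\<close>] by metis
    have "\<forall>g\<in>G. \<exists>c. a g = (\<Sum>b\<in>B. \<phi> (c b) * b)" using B(2)[OF a(1)] by blast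
    from bchoice[OF this] obtain c where c: "\<And>g. g \<in> G \<Longrightarrow> a g = (\<Sum>b\<in>B. \<phi> (c g b) * b)"
      by blast
    have "r = (\<Sum>(g, b)\<in>G \<times> B. \<phi> (c g b) * (g * b))"
      by (simp add: a(2) c sum_distrib_left sum.cartesian_product mult.left_commute)
    \<comment> \<open>Different pairs may have the same product; their coefficients are
      added.\<close>
    also have "\<dots> = (\<Sum>e\<in>B'. \<Sum>(g, b)\<in>{x \<in> G \<times> B. m x = e}. \<phi> (c g b) * (g * b))"
      unfolding B'_def using finite_G B(1) by (intro sum.image_gen) auto
    also have "\<dots> = (\<Sum>e\<in>B'. \<phi> (\<Sum>(g, b)\<in>{x \<in> G \<times> B. m x = e}. c g b) * e)"
      unfolding map_sum sum_distrib_right by (intro sum.cong) (auto simp: m_def)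
    finally show ?thesis by (intro exI)
  qed
  moreover have "finite B'" unfolding B'_def using finite_G B(1) by simp
  ultimately show ?case by blast
qed

text \<open>\<open>gr d\<close> lies in the ideal generated by the monomials of degree
  \<open>d\<close> in \<open>G\<close>. If \<open>g ^ N g \<in> I\<close> for all \<open>g\<close>,
  a monomial of degree above the sum of the \<open>N g\<close> is divisible by some
  \<open>g ^ N g\<close>.\<close>

lemma gr_eventually_subset_ideal:
  assumes I: "is_ideal I" and rad: "G \<subseteq> radical I"
  shows "\<exists>D. \<forall>d\<ge>D. gr d \<subseteq> I"
proof -
  define mons where "mons d = {\<Prod>g\<in>G. g ^ e g | e. (\<Sum>g\<in>G. e g) = d}" for d :: nat
  have gr_mons: "gr d \<subseteq> gen_ideal (mons d)" for d
  proof (induction d)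
    case 0
    have "1 \<in> mons 0" unfolding mons_def by (auto intro!: exI[of _ "\<lambda>_. 0"])
    then have "r * 1 \<in> gen_ideal (mons 0)" for r
      using is_idealD(3)[OF is_ideal_gen_ideal] gen_ideal_superset by blast
    then show ?case by auto
  next
    case (Suc d)
    have mult: "gen_ideal (mons d) \<subseteq> {x. g * x \<in> gen_ideal (mons (Suc d))}" if "g \<in> G" for g
    proof (rule gen_ideal_subset)
      note J = is_idealD[OF is_ideal_gen_ideal[of "mons (Suc d)"]]
      show "is_ideal {x. g * x \<in> gen_ideal (mons (Suc d))}"
        by (rule is_ideal_CollectI) (simp_all add: J(1,2,3) distrib_left mult.left_commute)
      show "mons d \<subseteq> {x. g * x \<in> gen_ideal (mons (Suc d))}"
      proof
        fix x assume "x \<in> mons d"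
        then obtain e where e: "x = (\<Prod>g\<in>G. g ^ e g)" "(\<Sum>g\<in>G. e g) = d" unfolding mons_def by blast
        let ?e = "e(g := Suc (e g))"
        have "(\<Prod>h\<in>G. h ^ ?e h) = g ^ ?e g * (\<Prod>h\<in>G - {g}. h ^ ?e h)"
          using finite_G that by (rule prod.remove)
        also have "(\<Prod>h\<in>G - {g}. h ^ ?e h) = (\<Prod>h\<in>G - {g}. h ^ e h)" by (rule prod.cong) auto
        finally have p: "(\<Prod>h\<in>G. h ^ ?e h) = g * x"
          using prod.remove[OF finite_G that, of "\<lambda>h. h ^ e h"] by (simp add: e(1) mult.assoc)
        have "(\<Sum>h\<in>G. ?e h) = ?e g + (\<Sum>h\<in>G - {g}. ?e h)" using finite_G that by (rule sum.remove)
        also have "(\<Sum>h\<in>G - {g}. ?e h) = (\<Sum>h\<in>G - {g}. e h)" by (rule sum.cong) auto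
        finally have "(\<Sum>h\<in>G. ?e h) = Suc d" using sum.remove[OF finite_G that, of e] by (simp add: e(2))
        then have "g * x \<in> mons (Suc d)" unfolding mons_def p[symmetric] by blast
        then show "x \<in> {x. g * x \<in> gen_ideal (mons (Suc d))}" using gen_ideal_superset by blast
      qed
    qed
    show ?case
    proof
      fix r assume "r \<in> gr (Suc d)"
      then obtain a where a: "\<And>g. g \<in> G \<Longrightarrow> a g \<in> gr d" "r = (\<Sum>g\<in>G. g * a g)"
        using gr_Suc by metis
      show "r \<in> gen_ideal (mons (Suc d))"
        unfolding a(2) using a(1) Suc mult by (intro is_ideal_sum[OF is_ideal_gen_ideal]) blast
    qed
  qed
  have "\<forall>g\<in>G. \<exists>n. g ^ n \<in> I" using rad by (auto simp: radical_def)
  from bchoice[OF this] obtain N where N: "\<And>g. g \<in> G \<Longrightarrow> g ^ N g \<in> I" by blast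
  have "mons d \<subseteq> I" if d: "d > (\<Sum>g\<in>G. N g)" for d
  proof
    fix x assume "x \<in> mons d"
    then obtain e where e: "x = (\<Prod>g\<in>G. g ^ e g)" "(\<Sum>g\<in>G. e g) = d" unfolding mons_def by blast
    have "\<exists>g\<in>G. N g \<le> e g"
    proof (rule ccontr)
      assume "\<not> (\<exists>g\<in>G. N g \<le> e g)"
      then have "(\<Sum>g\<in>G. e g) \<le> (\<Sum>g\<in>G. N g)" by (intro sum_mono) auto
      then show False using d e(2) by simp
    qed
    then obtain g where g: "g \<in> G" "N g \<le> e g" by blast
    then have "g ^ e g \<in> I" using is_ideal_power_mono[OF I N] by blast
    then show "x \<in> I"
      unfolding e(1) prod.remove[OF finite_G g(1)] using is_idealD(4)[OF I] by blast
  qed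
  then have "gr d \<subseteq> I" if "d \<ge> Suc (\<Sum>g\<in>G. N g)" for d
    using that gr_mons[of d] gen_ideal_subset[OF I, of "mons d"] by force
  then show ?thesis by blast
qed

text \<open>The fractions \<open>x\<^sub>t/s\<^sub>t\<close> define a function of degree 0 on the union of the D(s t), which is
  the punctured cone; multiplication by it maps the image of \<open>gr d\<close> in R/P to itself for large d,
  and this space is finite-dimensional.\<close>

lemma section_algebraic_mod_prime:
  assumes P: "is_prime_ideal P" "\<not> G \<subseteq> P" and T: "finite T"
    and s: "\<And>t. t \<in> T \<Longrightarrow> s t \<in> gr e" and x: "\<And>t. t \<in> T \<Longrightarrow> x t \<in> gr e"
    and sec: "\<And>t u. t \<in> T \<Longrightarrow> u \<in> T \<Longrightarrow> s u * x t - s t * x u \<in> P"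
    and rad: "G \<subseteq> radical (gen_ideal (s ` T))" and u: "u \<in> T"
  shows "\<exists>c n. c \<noteq> 0 \<and> degree c \<le> n \<and> homogenized_eval c n (x u) (s u) \<in> P"
proof -
  note PD = is_prime_idealD[OF P(1)]
  note I = is_idealD[OF PD(1)]
  obtain D where D: "\<And>d. d \<ge> D \<Longrightarrow> gr d \<subseteq> gen_ideal (s ` T)"
    using gr_eventually_subset_ideal[OF is_ideal_gen_ideal rad] by blast
  \<comment> \<open>Elements of degree at least \<open>D\<close> are combinations of the
    \<open>s t\<close>; in degree \<open>D + e\<close> the coefficients can be taken in degree
    \<open>D\<close>.\<close>
  define d where "d = D + e"
  obtain g where g: "g \<in> G" "g \<notin> P" using P(2) by blast
  have v0: "g ^ d \<in> gr d" "g ^ d \<notin> P" using G_power g PD(4) by blast+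
  \<comment> \<open>This is multiplication by the section: a sum of the \<open>s t * r' t\<close>
    goes to the sum of the \<open>x t * r' t\<close>, and agreement of the fractions modulo
    \<open>P\<close> gives the congruence.\<close>
  have step: "\<exists>a'\<in>gr d. s u * a' - x u * a \<in> P" if a: "a \<in> gr d" for a
  proof -
    have "a \<in> gen_ideal (s ` T)" using a D[of d] by (auto simp: d_def)
    then obtain r where r: "a = (\<Sum>t\<in>T. s t * r t)" using gen_ideal_image_finite[OF T] by blast
    define r' where "r' t = component D (r t)" for t
    have "a = component d a" using a by (simp add: component_homogeneous)
    also have "\<dots> = (\<Sum>t\<in>T. component d (s t * r t))" using r component_sum by metis
    also have "\<dots> = (\<Sum>t\<in>T. s t * r' t)"
      by (intro sum.cong refl, subst component_mult_homogeneous[OF s]) (auto simp: d_def r'_def)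
    finally have a': "a = (\<Sum>t\<in>T. s t * r' t)" .
    have "(\<Sum>t\<in>T. x t * r' t) \<in> gr d"
      using gr_mult[OF x component_mem] by (intro gr_sum) (auto simp: d_def r'_def add.commute)
    moreover have "s u * (\<Sum>t\<in>T. x t * r' t) - x u * a = (\<Sum>t\<in>T. r' t * (s u * x t - s t * x u))"
      unfolding a' sum_distrib_left sum_subtractf[symmetric] by (simp add: algebra_simps)
    moreover have "(\<Sum>t\<in>T. r' t * (s u * x t - s t * x u)) \<in> P"
      using sec u I(3) by (intro is_ideal_sum[OF PD(1)]) blast
    ultimately show ?thesis by metis
  qed
  obtain v where v: "v 0 = g ^ d" "\<And>j. v j \<in> gr d" "\<And>j. s u * v (Suc j) - x u * v j \<in> P"
  proof -
    obtain f where f: "\<And>a. a \<in> gr d \<Longrightarrow> f a \<in> gr d \<and> s u * f a - x u * a \<in> P" using step by metis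
    define v where "v j = (f ^^ j) (g ^ d)" for j
    have "v j \<in> gr d" for j by (induction j) (use f v0 in \<open>auto simp: v_def\<close>)
    then show ?thesis using f by (intro that[of v]) (auto simp: v_def)
  qed
  have sv: "s u ^ j * v j - x u ^ j * g ^ d \<in> P" for j
  proof (induction j)
    case (Suc j)
    have "s u ^ j * (s u * v (Suc j) - x u * v j) + x u * (s u ^ j * v j - x u ^ j * g ^ d) \<in> P"
      using v(3) Suc I(2,3) by blast
    then show ?case by (simp add: algebra_simps)
  qed (simp add: v I(1))
  obtain B where B: "finite B" "\<And>r. r \<in> gr d \<Longrightarrow> \<exists>c. r = (\<Sum>b\<in>B. \<phi> (c b) * b)"
    using gr_finitely_spanned[of d] by blast
  have "\<forall>j. \<exists>c. v j = (\<Sum>b\<in>B. \<phi> (c b) * b)" using B(2)[OF v(2)] by blast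
  from choice[OF this] obtain m where m: "\<And>j. v j = (\<Sum>b\<in>B. \<phi> (m j b) * b)" by blast
  define n where "n = card B"
  \<comment> \<open>The powers 0 to \<open>n\<close> of the section, applied to
    \<open>g ^ d\<close>, are \<open>n + 1\<close> vectors in a span of \<open>n\<close> elements. A
    dependence between them is a polynomial relation for the fraction, since
    \<open>g ^ d \<notin> P\<close> can be cancelled.\<close>
  obtain c where c: "\<exists>j\<in>{..n}. c j \<noteq> 0" "\<And>b. b \<in> B \<Longrightarrow> (\<Sum>j\<le>n. c j * m j b) = 0"
    using exists_linear_dependence[OF B(1), of "{..n}" m] by (auto simp: n_def)
  have dep: "(\<Sum>j\<le>n. \<phi> (c j) * v j) = 0"
  proof -
    have "(\<Sum>j\<le>n. \<phi> (c j) * v j) = (\<Sum>j\<le>n. \<Sum>b\<in>B. \<phi> (c j * m j b) * b)"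
      by (simp add: m sum_distrib_left mult mult.assoc)
    also have "\<dots> = (\<Sum>b\<in>B. \<phi> (\<Sum>j\<le>n. c j * m j b) * b)"
      by (subst sum.swap) (simp add: map_sum sum_distrib_right)
    finally show ?thesis using c(2) by (simp add: zero)
  qed
  define f where "f = (\<Sum>j\<le>n. monom (c j) j)"
  have coeff_f: "coeff f j = (if j \<le> n then c j else 0)" for j by (simp add: f_def coeff_sum)
  have "f \<noteq> 0" using c(1) coeff_f by (metis atMost_iff coeff_0)
  moreover have "degree f \<le> n" by (rule degree_le) (simp add: coeff_f)
  moreover have "homogenized_eval f n (x u) (s u) \<in> P"
  proof -
    have "(\<Sum>j\<le>n. \<phi> (c j) * s u ^ (n - j) * (s u ^ j * v j - x u ^ j * g ^ d)) \<in> P"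
      using sv I(3) by (intro is_ideal_sum[OF PD(1)]) blast
    also have "(\<Sum>j\<le>n. \<phi> (c j) * s u ^ (n - j) * (s u ^ j * v j - x u ^ j * g ^ d))
        = (\<Sum>j\<le>n. s u ^ n * (\<phi> (c j) * v j)) - (\<Sum>j\<le>n. \<phi> (c j) * x u ^ j * s u ^ (n - j) * g ^ d)"
      unfolding sum_subtractf[symmetric]
    proof (intro sum.cong refl)
      fix j assume "j \<in> {..n}"
      then have "s u ^ n = s u ^ (n - j) * s u ^ j" by (simp flip: power_add)
      then show "\<phi> (c j) * s u ^ (n - j) * (s u ^ j * v j - x u ^ j * g ^ d)
          = s u ^ n * (\<phi> (c j) * v j) - \<phi> (c j) * x u ^ j * s u ^ (n - j) * g ^ d"
        by (simp add: algebra_simps)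
    qed
    also have "\<dots> = - (homogenized_eval f n (x u) (s u) * g ^ d)"
      unfolding sum_distrib_left[symmetric] dep
      by (simp add: homogenized_eval_def sum_distrib_right coeff_f)
    finally have "homogenized_eval f n (x u) (s u) * g ^ d \<in> P" using I(5) by fastforce
    then show ?thesis using PD(3) v0(2) by blast
  qed
  ultimately show ?thesis by blast
qed

end

section \<open>The nerve of the irreducible components\<close>

text \<open>Only the sets \<open>F - {v}\<close> are incident to \<open>F\<close> from below, so
  this evaluates a coboundary at \<open>F\<close>.\<close>

lemma sum_incidence:
  fixes f :: "nat set \<Rightarrow> 'k::field"
  assumes "finite \<Gamma>" "finite F" "\<And>v. v \<in> F \<Longrightarrow> F - {v} \<in> \<Gamma>"
  shows "(\<Sum>H\<in>\<Gamma>. f H * incidence H F) = (\<Sum>v\<in>F. f (F - {v}) * (- 1) ^ card {x \<in> F. x < v})"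
proof -
  have inj: "inj_on (\<lambda>v. F - {v}) F" by (auto simp: inj_on_def)
  have "(\<Sum>H\<in>\<Gamma>. f H * incidence H F) = (\<Sum>H\<in>(\<lambda>v. F - {v}) ` F. f H * incidence H F)"
  proof (rule sum.mono_neutral_right[OF assms(1)])
    show "(\<lambda>v. F - {v}) ` F \<subseteq> \<Gamma>" using assms(3) by blast
    show "\<forall>H\<in>\<Gamma> - (\<lambda>v. F - {v}) ` F. f H * incidence H F = 0"
    proof
      fix H assume H: "H \<in> \<Gamma> - (\<lambda>v. F - {v}) ` F"
      have "\<not> (H \<subseteq> F \<and> card F = card H + 1)"
      proof
        assume *: "H \<subseteq> F \<and> card F = card H + 1"
        then have "card (F - H) = 1" using card_Diff_subset[of H F] finite_subset[OF _ assms(2)] by simp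
        then obtain v where "F - H = {v}" by (auto simp: card_1_singleton_iff)
        then have "H = F - {v}" "v \<in> F" using * by auto
        then show False using H by blast
      qed
      then show "f H * incidence H F = 0" by (auto simp: incidence_def)
    qed
  qed
  also have "\<dots> = (\<Sum>v\<in>F. f (F - {v}) * incidence (F - {v}) F)" by (simp add: sum.reindex[OF inj])
  also have "\<dots> = (\<Sum>v\<in>F. f (F - {v}) * (- 1) ^ card {x \<in> F. x < v})"
  proof (intro sum.cong refl)
    fix v assume v: "v \<in> F"
    have "card F = card (F - {v}) + 1" using v assms(2) by (metis Suc_eq_plus1 card_Suc_Diff1)
    moreover have "F - (F - {v}) = {v}" using v by blast
    ultimately show "f (F - {v}) * incidence (F - {v}) F = f (F - {v}) * (- 1) ^ card {x \<in> F. x < v}"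
      by (simp add: incidence_def)
  qed
  finally show ?thesis .
qed

lemma sum_incidence_edge:
  fixes f :: "nat set \<Rightarrow> 'k::field"
  assumes "finite \<Gamma>" "{i} \<in> \<Gamma>" "{j} \<in> \<Gamma>" "i < j"
  shows "(\<Sum>H\<in>\<Gamma>. f H * incidence H {i, j}) = f {j} - f {i}"
proof -
  have eqs: "{i, j} - {i} = {j}" "{i, j} - {j} = {i}" "{x \<in> {i, j}. x < i} = {}" "{x \<in> {i, j}. x < j} = {i}"
    using assms(4) by auto
  have "{i, j} - {v} \<in> \<Gamma>" if "v \<in> {i, j}" for v
    using that eqs(1,2) assms(2,3) by (metis empty_iff insert_iff)
  then have "(\<Sum>H\<in>\<Gamma>. f H * incidence H {i, j})
      = (\<Sum>v\<in>{i, j}. f ({i, j} - {v}) * (- 1) ^ card {x \<in> {i, j}. x < v})"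
    by (intro sum_incidence[OF assms(1)]) simp_all
  also have "\<dots> = f {j} - f {i}"
  proof -
    have two: "(\<Sum>v\<in>{i, j}. g v) = g i + g j" for g :: "nat \<Rightarrow> 'k"
      using assms(4) by simp
    show ?thesis unfolding two eqs by simp
  qed
  finally show ?thesis .
qed

lemma sum_incidence_triangle:
  fixes f :: "nat set \<Rightarrow> 'k::field"
  assumes "finite \<Gamma>" "{i, j} \<in> \<Gamma>" "{i, k} \<in> \<Gamma>" "{j, k} \<in> \<Gamma>" "i < j" "j < k"
  shows "(\<Sum>H\<in>\<Gamma>. f H * incidence H {i, j, k}) = f {j, k} - f {i, k} + f {i, j}"
proof -
  have eqs: "{i, j, k} - {i} = {j, k}" "{i, j, k} - {j} = {i, k}" "{i, j, k} - {k} = {i, j}"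
    "{x \<in> {i, j, k}. x < i} = {}" "{x \<in> {i, j, k}. x < j} = {i}" "{x \<in> {i, j, k}. x < k} = {i, j}"
    using assms(5,6) by auto
  have "{i, j, k} - {v} \<in> \<Gamma>" if "v \<in> {i, j, k}" for v
    using that eqs(1-3) assms(2-4) by (metis empty_iff insert_iff)
  then have "(\<Sum>H\<in>\<Gamma>. f H * incidence H {i, j, k})
      = (\<Sum>v\<in>{i, j, k}. f ({i, j, k} - {v}) * (- 1) ^ card {x \<in> {i, j, k}. x < v})"
    by (intro sum_incidence[OF assms(1)]) simp_all
  also have "\<dots> = f {j, k} - f {i, k} + f {i, j}"
  proof -
    have three: "(\<Sum>v\<in>{i, j, k}. g v) = g i + (g j + g k)" for g :: "nat \<Rightarrow> 'k"
      using assms(5,6) by simp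
    show ?thesis unfolding three eqs using assms(5) by simp
  qed
  finally show ?thesis .
qed

section \<open>Faces as sets of components with a common point\<close>

locale minimal_primes = std_graded \<phi> gr G for \<phi> :: "'k::field \<Rightarrow> 'r::comm_ring_1" and gr G +
  fixes n :: nat and p :: "nat \<Rightarrow> 'r set"
  assumes primes: "bij_betw p {1..n} {P. is_minimal_prime P}"
begin

abbreviation \<Delta> :: "nat set set" where "\<Delta> \<equiv> Delta gr n p"

lemma minimal_prime: "i \<in> {1..n} \<Longrightarrow> is_minimal_prime (p i)"
  using primes by (auto simp: bij_betw_def)

lemma prime: "i \<in> {1..n} \<Longrightarrow> is_prime_ideal (p i)"
  using minimal_prime by (simp add: is_minimal_prime_def)

lemma nilpotent: "(\<And>i. i \<in> {1..n} \<Longrightarrow> r \<in> p i) \<Longrightarrow> \<exists>m. r ^ m = 0"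
proof (rule nilpotent_if_in_all_minimal_primes)
  fix P :: "'r set" assume r: "\<And>i. i \<in> {1..n} \<Longrightarrow> r \<in> p i" and "is_minimal_prime P"
  then obtain i where "i \<in> {1..n}" "P = p i" using primes unfolding bij_betw_def by blast
  then show "r \<in> P" using r by blast
qed

lemma face_subset: "F \<in> \<Delta> \<Longrightarrow> F \<subseteq> {1..n}"
  by (simp add: Delta_def)

lemma finite_Delta: "finite \<Delta>"
proof (rule finite_subset)
  show "\<Delta> \<subseteq> Pow {1..n}" using face_subset by blast
qed simp

text \<open>\<open>Q\<close> is a point of the punctured cone common to the components in
  \<open>F\<close>; it contains the radical of the sum of their primes, which therefore differs from
  \<open>\<mm>\<close>.\<close>

lemma face_if_prime:
  assumes Q: "is_prime_ideal Q" "\<not> \<mm> \<subseteq> Q" and F: "F \<subseteq> {1..n}" "\<And>i. i \<in> F \<Longrightarrow> p i \<subseteq> Q"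
  shows "F \<in> \<Delta>"
proof -
  have "ideal_sum (p ` F) \<subseteq> Q"
    unfolding ideal_sum_def using F(2) is_prime_idealD(1)[OF Q(1)] by (intro gen_ideal_subset) auto
  then have "radical (ideal_sum (p ` F)) \<subseteq> Q" using radical_mono radical_prime[OF Q(1)] by metis
  then show ?thesis using Q(2) F(1) by (auto simp: Delta_def)
qed

text \<open>The radical lies in \<open>\<mm>\<close> and differs from it, so some element of
  \<open>\<mm>\<close> is outside, and a prime over the sum avoids that element.\<close>

lemma prime_if_face:
  assumes "F \<in> \<Delta>" "F \<noteq> {}"
  shows "\<exists>Q. is_prime_ideal Q \<and> \<not> \<mm> \<subseteq> Q \<and> (\<forall>i\<in>F. p i \<subseteq> Q)"
proof -
  have "ideal_sum (p ` F) \<subseteq> \<mm>"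
    unfolding ideal_sum_def
  proof (rule gen_ideal_subset[OF is_prime_idealD(1)[OF prime_irrelevant_ideal]])
    show "\<Union> (p ` F) \<subseteq> \<mm>"
      using minimal_prime_subset_irrelevant_ideal[OF minimal_prime] face_subset[OF assms(1)] by blast
  qed
  then have "radical (ideal_sum (p ` F)) \<subseteq> \<mm>"
    using radical_mono radical_prime[OF prime_irrelevant_ideal] by metis
  then obtain r where r: "r \<in> \<mm>" "r \<notin> radical (ideal_sum (p ` F))"
    using assms by (auto simp: Delta_def)
  have "is_ideal (ideal_sum (p ` F))" unfolding ideal_sum_def by (rule is_ideal_gen_ideal)
  from exists_prime_ideal_avoiding[OF this r(2)]
  obtain Q where Q: "is_prime_ideal Q" "ideal_sum (p ` F) \<subseteq> Q" "r \<notin> Q" by blast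
  have "p i \<subseteq> Q" if "i \<in> F" for i
    using Q(2) that gen_ideal_superset[of "\<Union> (p ` F)"] unfolding ideal_sum_def by blast
  then show ?thesis using Q(1,3) r(1) by blast
qed

lemma face_mono:
  assumes "F \<in> \<Delta>" "H \<subseteq> F"
  shows "H \<in> \<Delta>"
proof (cases "F = {}")
  case False
  then obtain Q where Q: "is_prime_ideal Q" "\<not> \<mm> \<subseteq> Q" "\<And>i. i \<in> F \<Longrightarrow> p i \<subseteq> Q"
    using prime_if_face[OF assms(1)] by auto
  show ?thesis using assms face_subset[OF assms(1)] Q by (intro face_if_prime[OF Q(1,2)]) auto
qed (use assms in auto)

text \<open>The open subsets \<open>U\<^sub>F\<close>, complements of the components outside the face F, cover the punctured
  cone. The cover is refined by principal open subsets D(s t) contained in \<open>U\<^sub>F\<close> for F = snd t.\<close>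

lemma principal_cover:
  obtains T :: "('r \<times> nat set) set" and s e L where "finite T" "\<And>t. t \<in> T \<Longrightarrow> snd t \<in> \<Delta>" "e > 0"
    "\<And>t. t \<in> T \<Longrightarrow> s t \<in> gr e"
    "\<And>t i. t \<in> T \<Longrightarrow> i \<in> {1..n} \<Longrightarrow> i \<notin> snd t \<Longrightarrow> s t \<in> p i"
    "\<And>I. is_ideal I \<Longrightarrow> (\<And>t. t \<in> T \<Longrightarrow> s t \<in> radical I) \<Longrightarrow> \<mm> \<subseteq> radical I"
    "\<And>t u v. t \<in> T \<Longrightarrow> u \<in> T \<Longrightarrow> v \<in> T \<Longrightarrow> snd t \<inter> snd u \<inter> snd v = {} \<Longrightarrow> (s t * s u * s v) ^ L = 0"
proof -
  \<comment> \<open>\<open>J F\<close> consists of the functions vanishing on all components outside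
    \<open>F\<close>; their nonvanishing loci lie in \<open>U_F\<close>. The sum \<open>K\<close> of
    these ideals measures whether the \<open>U_F\<close> cover.\<close>
  define J where "J F = {r. \<forall>i\<in>{1..n} - F. r \<in> p i}" for F
  have J: "is_ideal (J F)" for F
    unfolding J_def using is_idealD(1,2,3)[OF is_prime_idealD(1)[OF prime]]
    by (intro is_ideal_CollectI) auto
  define K where "K = {r. \<exists>f. (\<forall>F\<in>\<Delta>. f F \<in> J F) \<and> r = (\<Sum>F\<in>\<Delta>. f F)}"
  have K: "is_ideal K"
    unfolding K_def
  proof (rule is_ideal_CollectI)
    show "\<exists>f. (\<forall>F\<in>\<Delta>. f F \<in> J F) \<and> 0 = (\<Sum>F\<in>\<Delta>. f F)"
      using is_idealD(1)[OF J] by (intro exI[of _ "\<lambda>_. 0"]) simp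
    fix a assume "\<exists>f. (\<forall>F\<in>\<Delta>. f F \<in> J F) \<and> a = (\<Sum>F\<in>\<Delta>. f F)"
    then obtain f where f: "\<forall>F\<in>\<Delta>. f F \<in> J F" "a = (\<Sum>F\<in>\<Delta>. f F)" by blast
    show "\<exists>f. (\<forall>F\<in>\<Delta>. f F \<in> J F) \<and> c * a = (\<Sum>F\<in>\<Delta>. f F)" for c
      using f is_idealD(3)[OF J] by (intro exI[of _ "\<lambda>F. c * f F"]) (simp add: sum_distrib_left)
    fix b assume "\<exists>f. (\<forall>F\<in>\<Delta>. f F \<in> J F) \<and> b = (\<Sum>F\<in>\<Delta>. f F)"
    then obtain f' where f': "\<forall>F\<in>\<Delta>. f' F \<in> J F" "b = (\<Sum>F\<in>\<Delta>. f' F)" by blast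
    show "\<exists>f. (\<forall>F\<in>\<Delta>. f F \<in> J F) \<and> a + b = (\<Sum>F\<in>\<Delta>. f F)"
      using f f' is_idealD(2)[OF J] by (intro exI[of _ "\<lambda>F. f F + f' F"]) (simp add: sum.distrib)
  qed
  have JK: "J F \<subseteq> K" if "F \<in> \<Delta>" for F
  proof
    fix r assume "r \<in> J F"
    then show "r \<in> K"
      unfolding K_def using that finite_Delta is_idealD(1)[OF J]
      by (intro CollectI exI[of _ "\<lambda>H. if H = F then r else 0"]) simp
  qed
  \<comment> \<open>At a prime \<open>Q\<close> without \<open>g\<close> the components through
    \<open>Q\<close> form a face \<open>F\<close>. Choosing from each other \<open>p i\<close> an
    element outside \<open>Q\<close> and multiplying gives a member of \<open>J F\<close> outside
    \<open>Q\<close>.\<close>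
  have "G \<subseteq> radical K"
  proof (rule subsetI, rule ccontr)
    fix g assume g: "g \<in> G" "g \<notin> radical K"
    from exists_prime_ideal_avoiding[OF K g(2)]
    obtain Q where Q: "is_prime_ideal Q" "K \<subseteq> Q" "g \<notin> Q" by blast
    define F where "F = {i\<in>{1..n}. p i \<subseteq> Q}"
    have "F \<in> \<Delta>"
      using G_subset_irrelevant_ideal Q(1,3) g(1) by (intro face_if_prime[of Q]) (auto simp: F_def)
    have "\<forall>i\<in>{1..n} - F. \<exists>r. r \<in> p i \<and> r \<notin> Q" by (auto simp: F_def)
    from bchoice[OF this] obtain r where r: "\<And>i. i \<in> {1..n} - F \<Longrightarrow> r i \<in> p i \<and> r i \<notin> Q" by blast
    have "(\<Prod>i\<in>{1..n} - F. r i) \<in> J F"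
      unfolding J_def
    proof (intro CollectI ballI)
      fix i assume i: "i \<in> {1..n} - F"
      have "(\<Prod>i\<in>{1..n} - F. r i) = r i * (\<Prod>i\<in>{1..n} - F - {i}. r i)"
        by (rule prod.remove) (use i in auto)
      then show "(\<Prod>i\<in>{1..n} - F. r i) \<in> p i"
        using is_idealD(4)[OF is_prime_idealD(1)[OF prime]] r i by auto
    qed
    then have "(\<Prod>i\<in>{1..n} - F. r i) \<in> Q" using JK[OF \<open>F \<in> \<Delta>\<close>] Q(2) by blast
    then show False using prime_ideal_prod[OF Q(1)] r by blast
  qed
  then have "\<forall>g\<in>G. \<exists>N. g ^ N \<in> K" by (auto simp: radical_def)
  from bchoice[OF this] obtain N where N: "\<And>g. g \<in> G \<Longrightarrow> g ^ N g \<in> K" by blast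
  \<comment> \<open>One exponent for all of \<open>G\<close> gives all the \<open>s t\<close> the
    same degree; \<open>Suc\<close> keeps it positive.\<close>
  define e where "e = Suc (\<Sum>g\<in>G. N g)"
  have "g ^ e \<in> K" if "g \<in> G" for g
  proof (rule is_ideal_power_mono[OF K N[OF that]])
    show "N g \<le> e" using member_le_sum[of g G N] finite_G that by (simp add: e_def)
  qed
  then have "\<forall>g\<in>G. \<exists>f. (\<forall>F\<in>\<Delta>. f F \<in> J F) \<and> g ^ e = (\<Sum>F\<in>\<Delta>. f F)" unfolding K_def by blast
  from bchoice[OF this] obtain f where f: "\<And>g F. g \<in> G \<Longrightarrow> F \<in> \<Delta> \<Longrightarrow> f g F \<in> J F"
      "\<And>g. g \<in> G \<Longrightarrow> g ^ e = (\<Sum>F\<in>\<Delta>. f g F)" by blast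
  define T where "T = G \<times> \<Delta>"
  \<comment> \<open>The summands of \<open>g ^ e\<close> need not be homogeneous. Their parts of
    degree \<open>e\<close> still add up to \<open>g ^ e\<close> and stay in the relevant minimal
    primes, which are homogeneous.\<close>
  define s where "s = (\<lambda>(g, F). component e (f g F))"
  have T: "finite T" unfolding T_def using finite_G finite_Delta by blast
  have s_gr: "s t \<in> gr e" for t unfolding s_def by (auto split: prod.split intro: component_mem)
  have s_p: "s t \<in> p i" if "t \<in> T" "i \<in> {1..n}" "i \<notin> snd t" for t i
    using that f(1) minimal_prime_homogeneous[OF minimal_prime]
    by (auto simp: T_def s_def J_def)
  have sum_s: "g ^ e = (\<Sum>F\<in>\<Delta>. s (g, F))" if "g \<in> G" for g
  proof -
    have "g ^ e = component e (g ^ e)" using component_homogeneous[OF G_power[OF that, of e], of e] by simp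
    then show ?thesis by (simp add: f(2)[OF that] component_sum s_def)
  qed
  have rad: "\<mm> \<subseteq> radical I" if I: "is_ideal I" "\<And>t. t \<in> T \<Longrightarrow> s t \<in> radical I" for I
  proof (rule irrelevant_ideal_subset[OF is_ideal_radical[OF I(1)]])
    have "g ^ e \<in> radical I" if "g \<in> G" for g
      unfolding sum_s[OF that] using that I(2)
      by (intro is_ideal_sum[OF is_ideal_radical[OF I(1)]]) (auto simp: T_def)
    then have "g \<in> radical (radical I)" if "g \<in> G" for g using that by (auto simp: radical_def[of "radical I"])
    then show "G \<subseteq> radical I" by (auto simp: radical_idem)
  qed
  \<comment> \<open>For these triples the product lies in every minimal prime and is nilpotent; the
    sum of the finitely many exponents serves all of them.\<close>
  define E where "E = {(t, u, v) \<in> T \<times> T \<times> T. snd t \<inter> snd u \<inter> snd v = {}}"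
  have "E \<subseteq> T \<times> T \<times> T" by (auto simp: E_def)
  then have E: "finite E" using T by (simp add: finite_subset)
  have "\<forall>x\<in>E. \<exists>m. (case x of (t, u, v) \<Rightarrow> (s t * s u * s v) ^ m = 0)"
  proof
    fix x assume "x \<in> E"
    then obtain t u v where x: "x = (t, u, v)" "t \<in> T" "u \<in> T" "v \<in> T" "snd t \<inter> snd u \<inter> snd v = {}"
      by (auto simp: E_def)
    have "\<exists>m. (s t * s u * s v) ^ m = 0"
    proof (rule nilpotent)
      fix i assume i: "i \<in> {1..n}"
      note I = is_idealD[OF is_prime_idealD(1)[OF prime[OF i]]]
      have "s t \<in> p i \<or> s u \<in> p i \<or> s v \<in> p i" using x i s_p by blast
      then show "s t * s u * s v \<in> p i" using I(3,4) by blast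
    qed
    then show "\<exists>m. (case x of (t, u, v) \<Rightarrow> (s t * s u * s v) ^ m = 0)" by (simp add: x)
  qed
  from bchoice[OF this] obtain m where m: "\<And>t u v. (t, u, v) \<in> E \<Longrightarrow> (s t * s u * s v) ^ m (t, u, v) = 0"
    by fastforce
  have nil: "(s t * s u * s v) ^ sum m E = 0"
    if "t \<in> T" "u \<in> T" "v \<in> T" "snd t \<inter> snd u \<inter> snd v = {}" for t u v
  proof -
    have x: "(t, u, v) \<in> E" using that by (auto simp: E_def)
    then have "m (t, u, v) \<le> sum m E" using E by (intro member_le_sum) auto
    then show ?thesis using m[OF x] by (metis le_add_diff_inverse mult_zero_left power_add)
  qed
  show ?thesis
    by (rule that[of T e s "sum m E"]) (use T s_gr s_p rad nil in \<open>auto simp: e_def T_def\<close>)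
qed

section \<open>From cocycles to the vanishing of homology\<close>

lemma frobenius_exponent_base:
  assumes "frobenius_exponent TYPE('r) q"
  shows "frobenius_exponent TYPE('k) q"
  unfolding frobenius_exponent_def
proof (intro conjI allI)
  show "q > 0" using assms by (simp add: frobenius_exponent_def)
  fix x y :: 'k
  have "\<phi> ((x + y) ^ q - (x ^ q + y ^ q)) = 0"
    using assms by (simp add: diff add power frobenius_exponent_def)
  then have "(x + y) ^ q - (x ^ q + y ^ q) = 0"
    by (intro unit_not_mem[of "{0}"]) (auto simp: is_ideal_def)
  then show "(x + y) ^ q = x ^ q + y ^ q" by simp
qed

lemma depth_radical:
  assumes "depth_ge gr 3"
  obtains x y z where
    "\<And>a. x * a = 0 \<Longrightarrow> a = 0"
    "\<And>a. y * a \<in> gen_ideal {x} \<Longrightarrow> a \<in> gen_ideal {x}"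
    "\<And>a. z * a \<in> gen_ideal {y, x} \<Longrightarrow> a \<in> gen_ideal {y, x}"
    "{x, y, z} \<subseteq> \<mm>"
proof -
  obtain xs where xs: "length xs = 3" "set xs \<subseteq> \<mm>" "regular_sequence xs"
    using assms unfolding depth_ge_def by blast
  show ?thesis by (rule regular_sequence_3E[OF xs(3,1)]) (rule that, use xs(2) in auto)
qed

text \<open>A cocycle is constant on every face, so its values form a section of degree 0. This
  section comes from an element of R, whose component of degree 0 is the single scalar taken at all
  vertices.\<close>

lemma homology_0:
  assumes "depth_ge gr 3"
  shows "reduced_homology_vanishes TYPE('k) \<Delta> 0"
proof (rule reduced_homology_vanishesI[of \<Delta> n])
  show "\<Delta> \<subseteq> Pow {1..n}" using face_subset by blast
  show "H \<in> \<Delta>" if "F \<in> \<Delta>" "H \<subseteq> F" for F H using face_mono that .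
  fix a :: "nat set \<Rightarrow> 'k"
  assume coc: "\<And>F. F \<in> \<Delta> \<Longrightarrow> card F = 0 + 2 \<Longrightarrow>
    (\<Sum>H\<in>{H\<in>\<Delta>. card H = 0 + 1}. a H * incidence H F) = 0"
  have edge: "a {i} = a {j}" if "{i, j} \<in> \<Delta>" "i < j" for i j
  proof -
    have "{i} \<in> \<Delta>" "{j} \<in> \<Delta>" using face_mono[OF that(1)] by auto
    then have "(\<Sum>H\<in>{H\<in>\<Delta>. card H = 1}. a H * incidence H {i, j}) = a {j} - a {i}"
      using finite_Delta that(2) by (intro sum_incidence_edge) auto
    then show ?thesis using coc[OF that(1)] that(2) by simp
  qed
  have const: "a {i} = a {j}" if "F \<in> \<Delta>" "i \<in> F" "j \<in> F" for F i j
  proof -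
    have "{i, j} \<in> \<Delta>" using face_mono[OF that(1)] that by auto
    then show ?thesis using edge[of i j] edge[of j i] by (metis insert_commute nat_neq_iff)
  qed
  obtain x y z where reg: "\<And>a. x * a = 0 \<Longrightarrow> a = 0"
    "\<And>a. y * a \<in> gen_ideal {x} \<Longrightarrow> a \<in> gen_ideal {x}" "{x, y, z} \<subseteq> \<mm>"
    using depth_radical[OF assms] by metis
  obtain T :: "('r \<times> nat set) set" and s e L where T: "finite T" "\<And>t. t \<in> T \<Longrightarrow> snd t \<in> \<Delta>" "e > 0"
    and s: "\<And>t. t \<in> T \<Longrightarrow> s t \<in> gr e"
      "\<And>t i. t \<in> T \<Longrightarrow> i \<in> {1..n} \<Longrightarrow> i \<notin> snd t \<Longrightarrow> s t \<in> p i"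
    and cover: "\<And>I. is_ideal I \<Longrightarrow> (\<And>t. t \<in> T \<Longrightarrow> s t \<in> radical I) \<Longrightarrow> \<mm> \<subseteq> radical I"
    and nil: "\<And>t u v. t \<in> T \<Longrightarrow> u \<in> T \<Longrightarrow> v \<in> T \<Longrightarrow> snd t \<inter> snd u \<inter> snd v = {} \<Longrightarrow> (s t * s u * s v) ^ L = 0"
    by (rule principal_cover) blast
  have "\<mm> \<subseteq> radical (gen_ideal (s ` T))"
    using gen_ideal_superset radical_superset by (intro cover is_ideal_gen_ideal) blast
  then have rad: "x \<in> radical (gen_ideal (s ` T))" "y \<in> radical (gen_ideal (s ` T))" using reg(3) by auto
  \<comment> \<open>At the empty face the value is arbitrary; there the gluing below falls under the
    case of disjoint faces.\<close>
  define A where "A F = a {SOME i. i \<in> F}" for F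
  have A: "A F = a {i}" if "F \<in> \<Delta>" "i \<in> F" for F i
    unfolding A_def using const[OF that(1) someI[of "\<lambda>i. i \<in> F", OF that(2)] that(2)] .
  \<comment> \<open>For disjoint faces \<open>nil\<close> is applied to \<open>t\<close>,
    \<open>u\<close>, \<open>u\<close>, and \<open>(s t * s u * s u) ^ L\<close> divides
    \<open>s u ^ (2 * L) * s t ^ (2 * L)\<close>.\<close>
  define M where "M = 2 * L"
  have glue: "s u ^ M * (\<phi> (A (snd t)) * s t ^ M) - s t ^ M * (\<phi> (A (snd u)) * s u ^ M) \<in> {0}"
    if tu: "t \<in> T" "u \<in> T" for t u
  proof (cases "snd t \<inter> snd u = {}")
    case True
    have "s u ^ M * s t ^ M = (s t * s u * s u) ^ L * s t ^ L"
      unfolding M_def mult_2 power_add power_mult_distrib by (simp add: mult_ac)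
    then have z: "s u ^ M * s t ^ M = 0" using nil[OF tu tu(2)] True by auto
    have "s u ^ M * (\<phi> (A (snd t)) * s t ^ M) - s t ^ M * (\<phi> (A (snd u)) * s u ^ M)
        = (s u ^ M * s t ^ M) * (\<phi> (A (snd t)) - \<phi> (A (snd u)))" by (simp add: algebra_simps)
    then show ?thesis by (simp add: z)
  next
    case False
    then obtain i where "i \<in> snd t" "i \<in> snd u" by blast
    then have "A (snd t) = A (snd u)" using A T(2) tu by metis
    then show ?thesis by (simp add: mult_ac)
  qed
  have zero_ideal: "is_ideal {0 :: 'r}" by (auto simp: is_ideal_def)
  have gx: "gen_ideal {x} = {x * r | r. True}"
    using gen_ideal_insert[of x "{}"] by (auto simp: gen_ideal_empty)
  have "\<exists>r M'. \<forall>t\<in>T. s t ^ M' * (\<phi> (A (snd t)) * s t ^ M - r * s t ^ M) \<in> {0}"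
  proof (rule section_extends[OF zero_ideal _ _ rad glue])
    show "b \<in> {0}" if "x * b \<in> {0}" for b using that reg(1) by simp
    show "\<exists>i\<in>{0}. \<exists>r. b = i + x * r" if b: "y * b = i + x * r" "i \<in> {0}" for b i r
    proof -
      have "y * b \<in> gen_ideal {x}" using b by (auto simp: gx)
      from reg(2)[OF this] show ?thesis by (auto simp: gx)
    qed
  qed
  then obtain r M' where r: "\<And>t. t \<in> T \<Longrightarrow> s t ^ M' * (\<phi> (A (snd t)) * s t ^ M - r * s t ^ M) = 0"
    by auto
  \<comment> \<open>Since \<open>s t\<close> is homogeneous, comparison with a scalar involves only
    the part of \<open>r\<close> of degree 0.\<close>
  obtain \<rho> where \<rho>: "component 0 r = \<phi> \<rho>" using component_mem[of r 0] gr_zero by auto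
  have s_pow: "s t ^ m \<in> gr (e * m)" if "t \<in> T" for t m
    using gr_power[OF s(1)[OF that]] .
  have r0: "s t ^ (M' + M) * \<phi> (A (snd t) - \<rho>) = 0" if t: "t \<in> T" for t
  proof -
    have "0 = component (e * (M' + M)) (s t ^ (M' + M) * (\<phi> (A (snd t)) - r))"
      using r[OF t] component_homogeneous[OF gr_0] by (simp add: algebra_simps power_add)
    also have "\<dots> = s t ^ (M' + M) * component 0 (\<phi> (A (snd t)) - r)"
      by (subst component_mult_homogeneous[OF s_pow[OF t]]) simp
    also have "component 0 (\<phi> (A (snd t)) - r) = \<phi> (A (snd t) - \<rho>)"
      using gr_zero by (simp add: component_diff component_homogeneous[of _ 0] \<rho> diff)
    finally show ?thesis by simp
  qed
  have vertex: "a {i} = \<rho>" if i: "{i} \<in> \<Delta>" for i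
  proof -
    obtain Q where Q: "is_prime_ideal Q" "\<not> \<mm> \<subseteq> Q" "p i \<subseteq> Q"
      using prime_if_face[OF i] by auto
    \<comment> \<open>The cover reaches the point \<open>Q\<close>. As
      \<open>p i \<subseteq> Q\<close> and \<open>s t \<notin> Q\<close>, the vertex
      \<open>i\<close> belongs to \<open>snd t\<close>.\<close>
    obtain t where t: "t \<in> T" "s t \<notin> Q"
      using cover[OF is_prime_idealD(1)[OF Q(1)]] Q(2) radical_prime[OF Q(1)] by auto
    then have "i \<in> snd t" using s(2)[OF t(1), of i] Q(3) face_subset[OF i] by auto
    have "\<phi> (A (snd t) - \<rho>) \<in> Q"
      using r0[OF t(1)] is_prime_idealD[OF Q(1)] t(2) is_idealD(1) by metis
    then have "A (snd t) = \<rho>" using unit_not_mem is_prime_idealD(1,2)[OF Q(1)] by fastforce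
    then show ?thesis using A[OF T(2)[OF t(1)] \<open>i \<in> snd t\<close>] by simp
  qed
  show "\<exists>q b. frobenius_exponent TYPE('k) q \<and>
    (\<forall>H\<in>\<Delta>. card H = 0 + 1 \<longrightarrow> a H ^ q = (\<Sum>K\<in>\<Delta>. b K * incidence K H))"
  proof (intro exI conjI ballI impI)
    show "frobenius_exponent TYPE('k) 1" by (rule frobenius_exponent_1)
    fix H assume H: "H \<in> \<Delta>" "card H = 0 + 1"
    then obtain i where i: "H = {i}" by (auto simp: card_1_singleton_iff)
    \<comment> \<open>Only the empty face is incident to a vertex from below: a constant cochain is
      the coboundary of its value there, which is where the homology being reduced enters.\<close>
    have "(\<Sum>K\<in>\<Delta>. \<rho> * incidence K H) = (\<Sum>v\<in>H. \<rho> * (- 1) ^ card {x \<in> H. x < v})"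
      using face_mono[OF H(1)] finite_Delta by (intro sum_incidence) (auto simp: i)
    moreover have "{x. x = i \<and> x < i} = {}" by auto
    ultimately show "a H ^ 1 = (\<Sum>K\<in>\<Delta>. (\<lambda>_. \<rho>) K * incidence K H)"
      using vertex[of i] H(1) by (simp add: i)
  qed
qed

lemma homology_1:
  assumes "separably_closed TYPE('k)" "depth_ge gr 3"
  shows "reduced_homology_vanishes TYPE('k) \<Delta> 1"
proof (rule reduced_homology_vanishesI[of \<Delta> n])
  show "\<Delta> \<subseteq> Pow {1..n}" using face_subset by blast
  show "H \<in> \<Delta>" if "F \<in> \<Delta>" "H \<subseteq> F" for F H using face_mono that .
  fix a :: "nat set \<Rightarrow> 'k"
  assume coc: "\<And>F. F \<in> \<Delta> \<Longrightarrow> card F = 1 + 2 \<Longrightarrow>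
    (\<Sum>H\<in>{H\<in>\<Delta>. card H = 1 + 1}. a H * incidence H F) = 0"
  \<comment> \<open>The alternating extension to ordered pairs makes the cocycle identity hold for
    vertices of a face in any order, with repetitions.\<close>
  define A where "A i j = (if i < j then a {i, j} else if j < i then - a {i, j} else 0)" for i j
  have anti: "A i j = - A j i" for i j by (simp add: A_def insert_commute)
  have triangle: "A i j + A j k = A i k" if "{i, j, k} \<in> \<Delta>" "i < j" "j < k" for i j k
  proof -
    have "{i, j} \<in> \<Delta>" "{i, k} \<in> \<Delta>" "{j, k} \<in> \<Delta>" using face_mono[OF that(1)] by auto
    then have "(\<Sum>H\<in>{H\<in>\<Delta>. card H = 2}. a H * incidence H {i, j, k}) = a {j, k} - a {i, k} + a {i, j}"
      using finite_Delta that(2,3) by (intro sum_incidence_triangle) auto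
    then show ?thesis using coc[OF that(1)] that(2,3) by (simp add: A_def algebra_simps numeral_2_eq_2)
  qed
  have cocycle: "A i j + A j k = A i k" if F: "F \<in> \<Delta>" "i \<in> F" "j \<in> F" "k \<in> F" for F i j k
  proof -
    have *: "{i, j, k} \<in> \<Delta>" using face_mono[OF F(1)] F by auto
    have perm: "{i, k, j} = {i, j, k}" "{j, i, k} = {i, j, k}" "{j, k, i} = {i, j, k}"
      "{k, i, j} = {i, j, k}" "{k, j, i} = {i, j, k}" by auto
    have diag: "A l l = 0" for l by (simp add: A_def)
    consider "i = j" | "j = k" | "i = k" | "i < j" "j < k" | "i < k" "k < j" | "j < i" "i < k"
      | "j < k" "k < i" | "k < i" "i < j" | "k < j" "j < i" by linarith
    then show ?thesis
    proof cases
      case 4 then show ?thesis using triangle * by blast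
    next
      case 5 then show ?thesis using triangle[of i k j] * perm anti[of j k] by (simp add: algebra_simps)
    next
      case 6 then show ?thesis using triangle[of j i k] * perm anti[of i j] by (simp add: algebra_simps)
    next
      case 7 then show ?thesis using triangle[of j k i] * perm anti[of i j] anti[of i k] by (simp add: algebra_simps)
    next
      case 8 then show ?thesis using triangle[of k i j] * perm anti[of j k] anti[of i k] by (simp add: algebra_simps)
    next
      case 9 then show ?thesis
        using triangle[of k j i] * perm anti[of i j] anti[of j k] anti[of i k] by (simp add: algebra_simps)
    qed (use diag anti[of k j] anti[of i j] in auto)
  qed
  \<comment> \<open>The cocycle is integrated from a chosen base vertex of \<open>F\<close>.\<close>
  define h where "h F i = A (SOME j. j \<in> F) i" for F i
  have h: "A i j = h F j - h F i" if "F \<in> \<Delta>" "i \<in> F" "j \<in> F" for F i j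
    using cocycle[OF that(1) someI[of "\<lambda>j. j \<in> F", OF that(2)] that(2,3)] by (simp add: h_def algebra_simps)
  obtain x y z where reg: "\<And>a. x * a = 0 \<Longrightarrow> a = 0"
    "\<And>a. y * a \<in> gen_ideal {x} \<Longrightarrow> a \<in> gen_ideal {x}"
    "\<And>a. z * a \<in> gen_ideal {y, x} \<Longrightarrow> a \<in> gen_ideal {y, x}" "{x, y, z} \<subseteq> \<mm>"
    using depth_radical[OF assms(2)] by metis
  obtain T :: "('r \<times> nat set) set" and s e L where T: "finite T" "\<And>t. t \<in> T \<Longrightarrow> snd t \<in> \<Delta>" "e > 0"
    and s: "\<And>t. t \<in> T \<Longrightarrow> s t \<in> gr e"
      "\<And>t i. t \<in> T \<Longrightarrow> i \<in> {1..n} \<Longrightarrow> i \<notin> snd t \<Longrightarrow> s t \<in> p i"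
    and cover: "\<And>I. is_ideal I \<Longrightarrow> (\<And>t. t \<in> T \<Longrightarrow> s t \<in> radical I) \<Longrightarrow> \<mm> \<subseteq> radical I"
    and nil: "\<And>t u v. t \<in> T \<Longrightarrow> u \<in> T \<Longrightarrow> v \<in> T \<Longrightarrow> snd t \<inter> snd u \<inter> snd v = {} \<Longrightarrow> (s t * s u * s v) ^ L = 0"
    by (rule principal_cover) blast
  have "\<mm> \<subseteq> radical (gen_ideal (s ` T))"
    using gen_ideal_superset radical_superset by (intro cover is_ideal_gen_ideal) blast
  then have rad: "{x, y, z} \<subseteq> radical (gen_ideal (s ` T))" using reg(4) by auto
  \<comment> \<open>Every common vertex gives the same value. A triple without common vertex
    satisfies the cocycle condition through nilpotence, whatever the default value.\<close>
  define b where "b t u = (let I = snd t \<inter> snd u; i = SOME i. i \<in> I in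
    if I = {} then 0 else h (snd t) i - h (snd u) i)" for t u :: "'r \<times> nat set"
  have b: "b t u = h (snd t) i - h (snd u) i" if "t \<in> T" "u \<in> T" "i \<in> snd t" "i \<in> snd u" for t u i
  proof -
    define j where "j = (SOME i. i \<in> snd t \<inter> snd u)"
    have j: "j \<in> snd t \<inter> snd u" unfolding j_def using that(3,4) some_in_eq[of "snd t \<inter> snd u"] by blast
    have "h (snd t) i - h (snd t) j = h (snd u) i - h (snd u) j"
      using h[OF T(2)[OF that(1)], of j i] h[OF T(2)[OF that(2)], of j i] that(3,4) j by simp
    then have "h (snd t) i - h (snd u) i = h (snd t) j - h (snd u) j" by (simp add: algebra_simps)
    moreover have "b t u = h (snd t) j - h (snd u) j"
      using that(3,4) by (auto simp: b_def Let_def j_def)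
    ultimately show ?thesis by simp
  qed
  have "(s t * s u * s v) ^ L * (\<phi> (b t u) + \<phi> (b u v) - \<phi> (b t v)) = 0"
    if tuv: "t \<in> T" "u \<in> T" "v \<in> T" for t u v
  proof (cases "snd t \<inter> snd u \<inter> snd v = {}")
    case True
    then show ?thesis using nil[OF tuv] by simp
  next
    case False
    then obtain i where i: "i \<in> snd t" "i \<in> snd u" "i \<in> snd v" by blast
    have "b t u + b u v - b t v = 0" using b tuv i by simp
    then show ?thesis by (simp flip: add diff add: zero)
  qed
  then obtain M0 g0 where g0: "\<And>t u. t \<in> T \<Longrightarrow> u \<in> T \<Longrightarrow>
      s u ^ M0 * g0 t - s t ^ M0 * g0 u = \<phi> (b t u) * s t ^ M0 * s u ^ M0"
    using cocycle_splits[OF reg(1-3) rad, of L "\<lambda>t u. \<phi> (b t u)"] by blast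
  \<comment> \<open>One more factor \<open>s t\<close> in numerator and denominator makes the
    exponent positive, so that a prime contains \<open>S t\<close> exactly when it contains
    \<open>s t\<close>.\<close>
  define M where "M = Suc M0"
  define S where "S t = s t ^ M" for t
  \<comment> \<open>\<open>g0 t\<close> need not be homogeneous. As \<open>b t u\<close> is a
    scalar, the part of degree \<open>e * M\<close> of the numerator already splits the cocycle, and
    the fraction of \<open>X t\<close> by \<open>S t\<close> has degree 0.\<close>
  define X where "X t = component (e * M) (s t * g0 t)" for t
  have S: "S t \<in> gr (e * M)" if "t \<in> T" for t
    unfolding S_def using gr_power[OF s(1)[OF that]] .
  have split: "S u * X t - S t * X u = \<phi> (b t u) * S t * S u" if tu: "t \<in> T" "u \<in> T" for t u
  proof -
    have "S u * X t - S t * X u = component (e * M + e * M) (S u * (s t * g0 t) - S t * (s u * g0 u))"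
      unfolding component_diff component_mult_homogeneous[OF S[OF tu(1)]]
        component_mult_homogeneous[OF S[OF tu(2)]] by (simp add: X_def)
    also have "S u * (s t * g0 t) - S t * (s u * g0 u) = s t * s u * (s u ^ M0 * g0 t - s t ^ M0 * g0 u)"
      by (simp add: S_def M_def algebra_simps)
    also have "\<dots> = \<phi> (b t u) * (S t * S u)"
      unfolding g0[OF tu] by (simp add: S_def M_def algebra_simps)
    also have "component (e * M + e * M) (\<phi> (b t u) * (S t * S u)) = \<phi> (b t u) * (S t * S u)"
      using component_homogeneous[OF gr_scale[OF gr_mult[OF S[OF tu(1)] S[OF tu(2)]]]] by simp
    finally show ?thesis by (simp add: mult.assoc)
  qed
  have "\<exists>q \<alpha>. frobenius_exponent TYPE('r) q \<and>
      (\<forall>t\<in>T. s t \<notin> p i \<longrightarrow> (X t - \<phi> (h (snd t) i) * S t) ^ q - \<phi> \<alpha> * S t ^ q \<in> p i)"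
    if i: "i \<in> {1..n}" for i
  proof (cases "\<exists>u\<in>T. s u \<notin> p i")
    case False
    then show ?thesis using frobenius_exponent_1 by blast
  next
    case True
    then obtain u where u: "u \<in> T" "s u \<notin> p i" by blast
    note PD = is_prime_idealD[OF prime[OF i]]
    note I = is_idealD[OF PD(1)]
    have SP: "S t \<in> p i \<longleftrightarrow> s t \<in> p i" for t
      unfolding S_def M_def using PD(4) I(4) by (metis power_Suc)
    \<comment> \<open>If \<open>s t \<in> p i\<close>, the vertex \<open>i\<close> may be missing
      from \<open>snd t\<close>, where \<open>h\<close> has no meaning; the value 0 satisfies the
      gluing congruences because \<open>S t \<in> p i\<close>.\<close>
    define Y where "Y t = (if s t \<in> p i then 0 else X t - \<phi> (h (snd t) i) * S t)" for t
    have "gr e \<subseteq> \<mm>" using T(3) by (rule gr_pos_subset_irrelevant_ideal)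
    then have nG: "\<not> G \<subseteq> p i" using irrelevant_ideal_subset[OF PD(1)] u s(1) by blast
    have Y: "Y t \<in> gr (e * M)" if "t \<in> T" for t
      unfolding Y_def X_def using S[OF that] component_mem gr_0 gr_scale gr_diff by auto
    have sec: "S u * Y t - S t * Y u \<in> p i" if tu: "t \<in> T" "u \<in> T" for t u
    proof (cases "s t \<in> p i \<or> s u \<in> p i")
      case True
      then have "S u * Y t \<in> p i" "S t * Y u \<in> p i" using SP[of t] SP[of u] I(1,4) by (auto simp: Y_def)
      then show ?thesis by (rule I(6))
    next
      case False
      then have "i \<in> snd t" "i \<in> snd u" using s(2) i tu by blast+
      then have "\<phi> (b t u) = \<phi> (h (snd t) i) - \<phi> (h (snd u) i)" using b[OF tu] by (simp add: diff)
      moreover have "S u * Y t - S t * Y u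
          = (S u * X t - S t * X u) - (\<phi> (h (snd t) i) - \<phi> (h (snd u) i)) * S t * S u"
        using False by (simp add: Y_def algebra_simps)
      ultimately have "S u * Y t - S t * Y u = 0" using split[OF tu] by simp
      then show ?thesis using I(1) by simp
    qed
    have GS: "G \<subseteq> radical (gen_ideal (S ` T))"
    proof -
      have "s t \<in> radical (gen_ideal (S ` T))" if "t \<in> T" for t
      proof -
        have "s t ^ M \<in> gen_ideal (S ` T)" using gen_ideal_superset[of "S ` T"] that by (auto simp: S_def)
        then show ?thesis unfolding radical_def by blast
      qed
      then show ?thesis using cover[OF is_ideal_gen_ideal] G_subset_irrelevant_ideal by blast
    qed
    have "\<exists>c m. c \<noteq> 0 \<and> degree c \<le> m \<and> homogenized_eval c m (Y u) (S u) \<in> p i"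
      by (rule section_algebraic_mod_prime[OF prime[OF i] nG T(1) S Y sec GS u(1)])
    then obtain c m where "c \<noteq> 0" "degree c \<le> m" "homogenized_eval c m (Y u) (S u) \<in> p i"
      by blast
    then obtain q \<alpha> where q: "frobenius_exponent TYPE('r) q" "Y u ^ q - \<phi> \<alpha> * S u ^ q \<in> p i"
      using purely_inseparable_mod_prime[OF assms(1) prime[OF i]] u(2) SP by metis
    \<comment> \<open>Modulo \<open>p i\<close> the fractions at \<open>t\<close> and
      \<open>u\<close> agree, so the scalar \<open>\<alpha>\<close> found at \<open>u\<close> serves
      every \<open>t\<close>.\<close>
    have "(X t - \<phi> (h (snd t) i) * S t) ^ q - \<phi> \<alpha> * S t ^ q \<in> p i" if t: "t \<in> T" "s t \<notin> p i" for t
    proof -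
      have "(S u * Y t) ^ q - (S t * Y u) ^ q + S t ^ q * (Y u ^ q - \<phi> \<alpha> * S u ^ q) \<in> p i"
        by (intro I(2) I(3)[OF q(2)] is_ideal_power_diff[OF PD(1)] sec t u)
      also have "(S u * Y t) ^ q - (S t * Y u) ^ q + S t ^ q * (Y u ^ q - \<phi> \<alpha> * S u ^ q)
          = S u ^ q * (Y t ^ q - \<phi> \<alpha> * S t ^ q)" by (simp add: algebra_simps power_mult_distrib)
      finally have "Y t ^ q - \<phi> \<alpha> * S t ^ q \<in> p i" using PD(3,4) u(2) SP by blast
      then show ?thesis using t(2) by (simp add: Y_def)
    qed
    then show ?thesis using q(1) by blast
  qed
  then have "\<forall>i\<in>{1..n}. \<exists>q \<alpha>. frobenius_exponent TYPE('r) q \<and>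
      (\<forall>t\<in>T. s t \<notin> p i \<longrightarrow> (X t - \<phi> (h (snd t) i) * S t) ^ q - \<phi> \<alpha> * S t ^ q \<in> p i)" by blast
  then obtain q \<alpha> where q: "\<And>i. i \<in> {1..n} \<Longrightarrow> frobenius_exponent TYPE('r) (q i)"
    and \<alpha>: "\<And>i t. i \<in> {1..n} \<Longrightarrow> t \<in> T \<Longrightarrow> s t \<notin> p i \<Longrightarrow>
      (X t - \<phi> (h (snd t) i) * S t) ^ q i - \<phi> (\<alpha> i) * S t ^ q i \<in> p i"
    unfolding bchoice_iff by blast
  \<comment> \<open>The exponents of the components differ; their product is a common one, and
    \<open>\<beta> i\<close> is \<open>\<alpha> i\<close> raised to the complementary
    factor.\<close>
  define r where "r = (\<Prod>i\<in>{1..n}. q i)"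
  have r: "frobenius_exponent TYPE('r) r" unfolding r_def using q by (rule frobenius_exponent_prod)
  define \<beta> where "\<beta> i = \<alpha> i ^ (\<Prod>j\<in>{1..n} - {i}. q j)" for i
  have power_value: "X t ^ r - \<phi> (h (snd t) i ^ r + \<beta> i) * S t ^ r \<in> p i"
    if i: "i \<in> {1..n}" and t: "t \<in> T" "s t \<notin> p i" for i t
  proof -
    let ?q = "\<Prod>j\<in>{1..n} - {i}. q j"
    have rq: "r = q i * ?q" unfolding r_def using i by (intro prod.remove) auto
    have "((X t - \<phi> (h (snd t) i) * S t) ^ q i) ^ ?q - (\<phi> (\<alpha> i) * S t ^ q i) ^ ?q \<in> p i"
      by (intro is_ideal_power_diff is_prime_idealD(1)[OF prime[OF i]] \<alpha> i t)
    then have "(X t - \<phi> (h (snd t) i) * S t) ^ r - \<phi> (\<beta> i) * S t ^ r \<in> p i"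
      by (simp add: rq power_mult power_mult_distrib \<beta>_def power)
    then show ?thesis
      by (simp add: frobenius_exponent_diff[OF r] power_mult_distrib power add algebra_simps)
  qed
  have edge: "a {i, j} ^ r = \<beta> i - \<beta> j" if ij: "{i, j} \<in> \<Delta>" "i < j" for i j
  proof -
    obtain Q where Q: "is_prime_ideal Q" "\<not> \<mm> \<subseteq> Q" "p i \<subseteq> Q" "p j \<subseteq> Q"
      using prime_if_face[OF ij(1)] by auto
    note I = is_idealD[OF is_prime_idealD(1)[OF Q(1)]]
    obtain t where t: "t \<in> T" "s t \<notin> Q"
      using cover[OF is_prime_idealD(1)[OF Q(1)]] Q(2) radical_prime[OF Q(1)] by auto
    have mem: "i \<in> {1..n}" "j \<in> {1..n}" using face_subset[OF ij(1)] by auto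
    then have snd: "i \<in> snd t" "j \<in> snd t" using s(2)[OF t(1)] Q(3,4) t(2) by blast+
    \<comment> \<open>At the common point \<open>Q\<close> both components describe the fraction of
      \<open>X t ^ r\<close> by \<open>S t ^ r\<close>; subtraction eliminates it and leaves
      scalars.\<close>
    have "(X t ^ r - \<phi> (h (snd t) j ^ r + \<beta> j) * S t ^ r) - (X t ^ r - \<phi> (h (snd t) i ^ r + \<beta> i) * S t ^ r) \<in> Q"
      using power_value[OF mem(1) t(1)] power_value[OF mem(2) t(1)] Q(3,4) t(2) by - (rule I(6); blast)
    then have "S t ^ r * \<phi> (h (snd t) i ^ r + \<beta> i - (h (snd t) j ^ r + \<beta> j)) \<in> Q"
      by (simp add: diff algebra_simps)
    moreover have "S t ^ r \<notin> Q" using is_prime_idealD(4)[OF Q(1)] t(2) by (auto simp: S_def)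
    ultimately have "\<phi> (h (snd t) i ^ r + \<beta> i - (h (snd t) j ^ r + \<beta> j)) \<in> Q"
      using is_prime_idealD(3)[OF Q(1)] by blast
    then have "h (snd t) i ^ r + \<beta> i - (h (snd t) j ^ r + \<beta> j) = 0"
      using unit_not_mem[OF is_prime_idealD(1,2)[OF Q(1)]] by blast
    then have "h (snd t) j ^ r - h (snd t) i ^ r = \<beta> i - \<beta> j" by (simp add: algebra_simps)
    moreover have "a {i, j} = h (snd t) j - h (snd t) i"
      using h[OF T(2)[OF t(1)] snd] ij(2) by (simp add: A_def)
    ultimately show ?thesis
      using frobenius_exponent_diff[OF frobenius_exponent_base[OF r]] by simp
  qed
  show "\<exists>q b. frobenius_exponent TYPE('k) q \<and>
    (\<forall>H\<in>\<Delta>. card H = 1 + 1 \<longrightarrow> a H ^ q = (\<Sum>K\<in>\<Delta>. b K * incidence K H))"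
  proof (intro exI conjI ballI impI)
    show "frobenius_exponent TYPE('k) r" by (rule frobenius_exponent_base[OF r])
    fix H assume H: "H \<in> \<Delta>" "card H = 1 + 1"
    then obtain i j where ij: "H = {i, j}" "i < j"
      by (auto simp: numeral_2_eq_2 card_Suc_eq) (metis insert_commute linorder_less_linear)
    have "{i} \<in> \<Delta>" "{j} \<in> \<Delta>" using face_mono[OF H(1)] ij(1) by auto
    \<comment> \<open>The sign is due to orientation: the coboundary at an edge is the value at
      \<open>j\<close> minus the value at \<open>i\<close>, while the edge carries
      \<open>\<beta> i - \<beta> j\<close>.\<close>
    then show "a H ^ r = (\<Sum>K\<in>\<Delta>. (\<lambda>K. - \<beta> (the_elem K)) K * incidence K H)"
      unfolding ij(1) using edge[of i j] H(1) ij
      by (subst sum_incidence_edge[OF finite_Delta _ _ ij(2)]) simp_all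
  qed
qed

end

theorem theorem1p3:
  fixes \<phi> :: "'k::field \<Rightarrow> 'r::comm_ring_1"
    and gr :: "nat \<Rightarrow> 'r set"
    and n :: nat
    and p :: "nat \<Rightarrow> 'r set"
  assumes "separably_closed TYPE('k)"
    and "standard_graded \<phi> gr"
    and "bij_betw p {1..n} {P. is_minimal_prime P}"
    and "depth_ge gr 3"
  shows "reduced_homology_vanishes TYPE('k) (Delta gr n p) 0
       \<and> reduced_homology_vanishes TYPE('k) (Delta gr n p) 1"
proof -
  have graded: "graded_algebra \<phi> gr" using assms(2) by (simp add: standard_graded_def)
  obtain G where "finite G" "G \<subseteq> gr 1" "\<And>r. r \<in> alg_gen \<phi> G" "gr 0 = range \<phi>"
    using assms(2) unfolding standard_graded_def by blast
  with graded assms(3) interpret minimal_primes \<phi> gr G n p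
    by unfold_locales (auto simp: graded_algebra_def)
  show ?thesis using homology_0[OF assms(4)] homology_1[OF assms(1,4)] by blast
qed

end
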